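(* Let $f(x)=Ax+\sum_{j\ge 2}f_j(x)$ be a formal vector field on $\mathbb C^n$ in Poincaré–Dulac normal form, with $A_s\neq 0$, and let $g\in\mathcal N_0^{\rm for}(f)$ with $g(0)=0$. Then: (a) There exists $\beta\in\mathbb C[[x_1,\ldots,x_n]]$ such that $$[g-\beta f,\,f]=\alpha f,\qquad X_{A_s}(\alpha)=0$$ for some $\alpha=\alpha_0+\alpha_1+\cdots\in\mathbb C[[x_1,\ldots,x_n]]$ (with $\alpha_i$ homogeneous of degree $i$), and $\alpha_0=0$. In particular $$\mathcal N_0^{\rm for}(f)=\mathcal C_0^{\rm for}(f)+\{\beta f;\ \beta\in\mathbb C[[x_1,\ldots,x_n]]\}$$ whenever $A_s$ admits only constant formal first integrals. (b) With $\beta$ as in (a), the vector field $h:=g-\beta f$ satisfies $[A_s,h]=0$. (c) Let $h$ be as in (b), let $C$ denote the linear part of $h$ (so $h(x)=Cx+h_2(x)+\cdots$), and let $C_s$ be the semisimple part of $C$. Then there exist an invertible series $\sigma=1+\sigma_1+\cdots$ and $\alpha^*\in\mathbb C[[x_1,\ldots,x_n]]$ such that $X_{A_s}(\sigma)=0$ and $$[h,\,\sigma f]=\alpha^*\cdot\sigma f,\qquad X_{A_s}(\alpha^* )=X_{C_s}(\alpha^* )=0.$$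
   Context: Formal vector fields on $\mathbb C^n$ are elements of $\mathbb C[[x_1,\ldots,x_n]]^n$; a matrix $B$ is identified with the linear vector field $x\mapsto Bx$. For a vector field $g$ and a scalar series $\phi$, $X_g(\phi)(x)=D\phi(x)g(x)$; $\phi$ is a first integral of $g$ if $X_g(\phi)=0$ (constants are included). The Lie bracket is $[g,h](x)=Dh(x)g(x)-Dg(x)h(x)$. The formal centralizer and normalizer are $$\mathcal C_0^{\rm for}(f)=\{g\in\mathbb C[[x_1,\ldots,x_n]]^n;\ [g,f]=0\},$$ $$\mathcal N_0^{\rm for}(f)=\{g\in\mathbb C[[x_1,\ldots,x_n]]^n;\ [g,f]=\lambda f\text{ for some }\lambda\in\mathbb C[[x_1,\ldots,x_n]]\}.$$ For $f(x)=Ax+\sum_{j\ge2}f_j(x)$ with $f_j$ homogeneous of degree $j$, let $A=A_s+A_n$ be the Jordan–Chevalley decomposition ($A_s$ semisimple, $A_n$ nilpotent, commuting). $f$ is in Poincaré–Dulac normal form (PDNF) if $[A_s,f]=0$. *)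

theory Defs
  imports "HOL-Analysis.Analysis"
begin

text \<open>The variables are indexed by a finite type \<open>'n\<close>; a monomial is given by its exponent
  vector in \<open>nat ^ 'n\<close>, so that \<open>axis i 1\<close> is the exponent of the variable \<open>x_i\<close>.\<close>

typedef (overloaded) ('a, 'n::finite) mfps = "UNIV :: (nat ^ 'n \<Rightarrow> 'a) set"
  morphisms mfps_coeff Mfps
  by simp

lemma mfps_coeff_Mfps [simp]: "mfps_coeff (Mfps u) = u"
  by (simp add: Mfps_inverse)

lemma mfps_eq_iff: "p = q \<longleftrightarrow> (\<forall>m. mfps_coeff p m = mfps_coeff q m)"
  by (metis mfps_coeff_inject ext)

lemma mfps_eqI: "(\<And>m. mfps_coeff p m = mfps_coeff q m) \<Longrightarrow> p = q"
  by (simp add: mfps_eq_iff)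

lemma finite_exponents_le: "finite {a :: nat ^ 'n. \<forall>i. a $ i \<le> m $ i}"
proof (rule finite_subset)
  show "{a :: nat ^ 'n. \<forall>i. a $ i \<le> m $ i} \<subseteq> vec_lambda ` (PiE UNIV (\<lambda>i. {..m $ i}))"
  proof
    fix a :: "nat ^ 'n" assume "a \<in> {a. \<forall>i. a $ i \<le> m $ i}"
    then have "($) a \<in> PiE UNIV (\<lambda>i. {..m $ i})" by auto
    moreover have "a = vec_lambda (($) a)" by simp
    ultimately show "a \<in> vec_lambda ` (PiE UNIV (\<lambda>i. {..m $ i}))" by blast
  qed
  show "finite (vec_lambda ` (PiE (UNIV :: 'n set) (\<lambda>i. {..m $ i})))"
    by (intro finite_imageI finite_PiE) auto
qed

definition splits :: "nat ^ 'n \<Rightarrow> ((nat ^ 'n) \<times> (nat ^ 'n)) set" where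
  "splits m = {(a, b). a + b = m}"

lemma mem_splits [simp]: "(a, b) \<in> splits m \<longleftrightarrow> a + b = m"
  by (simp add: splits_def)

lemma finite_splits [simp]: "finite (splits (m :: nat ^ 'n))"
proof (rule finite_subset)
  show "splits m \<subseteq> {a. \<forall>i. a $ i \<le> m $ i} \<times> {a. \<forall>i. a $ i \<le> m $ i}"
    by (auto simp: splits_def)
qed (intro finite_cartesian_product finite_exponents_le)

instantiation mfps :: (zero, finite) zero
begin
definition zero_mfps_def: "0 = Mfps (\<lambda>_. 0)"
instance ..
end

instantiation mfps :: ("{zero, one}", finite) one
begin
definition one_mfps_def: "1 = Mfps (\<lambda>m. if m = 0 then 1 else 0)"
instance ..
end

instantiation mfps :: (plus, finite) plus
begin
definition plus_mfps_def: "p + q = Mfps (\<lambda>m. mfps_coeff p m + mfps_coeff q m)"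
instance ..
end

instantiation mfps :: (minus, finite) minus
begin
definition minus_mfps_def: "p - q = Mfps (\<lambda>m. mfps_coeff p m - mfps_coeff q m)"
instance ..
end

instantiation mfps :: (uminus, finite) uminus
begin
definition uminus_mfps_def: "- p = Mfps (\<lambda>m. - mfps_coeff p m)"
instance ..
end

instantiation mfps :: ("{comm_monoid_add, times}", finite) times
begin
definition times_mfps_def:
  "p * q = Mfps (\<lambda>m. \<Sum>(a, b)\<in>splits m. mfps_coeff p a * mfps_coeff q b)"
instance ..
end

lemma mfps_coeff_0 [simp]: "mfps_coeff 0 m = 0"
  and mfps_coeff_1: "mfps_coeff 1 m = (if m = 0 then 1 else 0)"
  and mfps_coeff_add [simp]: "mfps_coeff (p + q) m = mfps_coeff p m + mfps_coeff q m"
  and mfps_coeff_diff [simp]: "mfps_coeff (p - q) m = mfps_coeff p m - mfps_coeff q m"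
  and mfps_coeff_uminus [simp]: "mfps_coeff (- p) m = - mfps_coeff p m"
  and mfps_coeff_mult: "mfps_coeff (p * q) m = (\<Sum>(a, b)\<in>splits m. mfps_coeff p a * mfps_coeff q b)"
  by (simp_all add: zero_mfps_def one_mfps_def plus_mfps_def minus_mfps_def uminus_mfps_def
      times_mfps_def)

instance mfps :: (comm_ring_1, finite) comm_ring_1
proof
  fix p q r :: "('a, 'b) mfps"
  show "p * q * r = p * (q * r)"
  proof (rule mfps_eqI)
    fix m
    have "mfps_coeff (p * q * r) m =
      (\<Sum>(x, y)\<in>Sigma (splits m) (\<lambda>(s, c). splits s).
        mfps_coeff p (fst y) * mfps_coeff q (snd y) * mfps_coeff r (snd x))"
      by (simp add: mfps_coeff_mult sum_distrib_right case_prod_unfold sum.Sigma)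
    also have "\<dots> = (\<Sum>(x, y)\<in>Sigma (splits m) (\<lambda>(a, s). splits s).
        mfps_coeff p (fst x) * (mfps_coeff q (fst y) * mfps_coeff r (snd y)))"
      by (rule sum.reindex_bij_witness
            [where i = "\<lambda>((a, s), (b, c)). ((a + b, c), (a, b))"
               and j = "\<lambda>((s, c), (a, b)). ((a, b + c), (b, c))"])
         (auto simp: add.assoc mult.assoc)
    also have "\<dots> = mfps_coeff (p * (q * r)) m"
      by (simp add: mfps_coeff_mult sum_distrib_left case_prod_unfold sum.Sigma)
    finally show "mfps_coeff (p * q * r) m = mfps_coeff (p * (q * r)) m" .
  qed
  show "p * q = q * p"
    by (rule mfps_eqI, unfold mfps_coeff_mult,
        rule sum.reindex_bij_witness[where i = prod.swap and j = prod.swap])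
       (auto simp: add.commute mult.commute)
  show "1 * p = p"
  proof (rule mfps_eqI)
    fix m
    have "mfps_coeff (1 * p) m = (\<Sum>(a, b)\<in>{(0, m)}. mfps_coeff (1 :: ('a, 'b) mfps) a * mfps_coeff p b)"
      unfolding mfps_coeff_mult
      by (rule sum.mono_neutral_right) (auto simp: mfps_coeff_1 split: if_splits)
    then show "mfps_coeff (1 * p) m = mfps_coeff p m" by (simp add: mfps_coeff_1)
  qed
  show "(p + q) * r = p * r + q * r"
    by (rule mfps_eqI)
       (simp add: mfps_coeff_mult distrib_right sum.distrib case_prod_unfold)
  show "(0 :: ('a, 'b) mfps) \<noteq> 1"
    by (metis mfps_coeff_0 mfps_coeff_1 zero_neq_one)
qed (auto intro!: mfps_eqI simp: add.assoc add.commute)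

definition mfps_const :: "'a::zero \<Rightarrow> ('a, 'n::finite) mfps" where
  "mfps_const c = Mfps (\<lambda>m. if m = 0 then c else 0)"

definition mfps_var :: "'n::finite \<Rightarrow> ('a::zero_neq_one, 'n) mfps" where
  "mfps_var i = Mfps (\<lambda>m. if m = axis i 1 then 1 else 0)"

definition pderiv_mfps :: "'n::finite \<Rightarrow> ('a::semiring_1, 'n) mfps \<Rightarrow> ('a, 'n) mfps" where
  "pderiv_mfps i p = Mfps (\<lambda>m. of_nat (m $ i + 1) * mfps_coeff p (m + axis i 1))"

type_synonym 'n series = "(complex, 'n) mfps"

type_synonym 'n vfield = "'n series ^ 'n"

definition jacobian_mfps :: "'n::finite vfield \<Rightarrow> 'n series ^ 'n ^ 'n" where
  "jacobian_mfps h = (\<chi> i j. pderiv_mfps j (h $ i))"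

definition lie_deriv :: "'n::finite vfield \<Rightarrow> 'n series \<Rightarrow> 'n series" where
  "lie_deriv g p = (\<Sum>j\<in>UNIV. pderiv_mfps j p * g $ j)"

definition first_integral :: "'n::finite vfield \<Rightarrow> 'n series \<Rightarrow> bool" where
  "first_integral g p \<longleftrightarrow> lie_deriv g p = 0"

definition lie_bracket :: "'n::finite vfield \<Rightarrow> 'n vfield \<Rightarrow> 'n vfield" where
  "lie_bracket g h = jacobian_mfps h *v g - jacobian_mfps g *v h"

definition linear_vfield :: "complex ^ 'n ^ 'n \<Rightarrow> 'n::finite vfield" where
  "linear_vfield B = (\<chi> i j. mfps_const (B $ i $ j)) *v (\<chi> j. mfps_var j)"

definition value_at_0 :: "'n::finite vfield \<Rightarrow> complex ^ 'n" where
  "value_at_0 g = (\<chi> i. mfps_coeff (g $ i) 0)"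

definition linear_part :: "'n::finite vfield \<Rightarrow> complex ^ 'n ^ 'n" where
  "linear_part g = (\<chi> i j. mfps_coeff (g $ i) (axis j 1))"

definition centralizer :: "'n::finite vfield \<Rightarrow> 'n vfield set" where
  "centralizer f = {g. lie_bracket g f = 0}"

definition normalizer :: "'n::finite vfield \<Rightarrow> 'n vfield set" where
  "normalizer f = {g. \<exists>l :: 'n series. lie_bracket g f = l *s f}"

definition semisimple_matrix :: "complex ^ 'n ^ 'n \<Rightarrow> bool" where
  "semisimple_matrix B \<longleftrightarrow>
    (\<forall>W. vec.subspace W \<and> (\<forall>w\<in>W. B *v w \<in> W) \<longrightarrow>
      (\<exists>U. vec.subspace U \<and> (\<forall>u\<in>U. B *v u \<in> U) \<and>
           W \<inter> U = {0} \<and> (\<forall>v. \<exists>w\<in>W. \<exists>u\<in>U. v = w + u)))"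

text \<open>The power of a matrix is iterated \<open>**\<close>; the operator \<open>*\<close> on \<open>vec\<close> is not the
  matrix product.\<close>

definition nilpotent_matrix :: "complex ^ 'n ^ 'n \<Rightarrow> bool" where
  "nilpotent_matrix B \<longleftrightarrow> (\<exists>k. (((**) B) ^^ k) (mat 1) = 0)"

definition jordan_chevalley ::
    "complex ^ 'n ^ 'n \<Rightarrow> complex ^ 'n ^ 'n \<Rightarrow> complex ^ 'n ^ 'n \<Rightarrow> bool" where
  "jordan_chevalley B S N \<longleftrightarrow>
    B = S + N \<and> semisimple_matrix S \<and> nilpotent_matrix N \<and> S ** N = N ** S"

text \<open>The pair \<open>(S, N)\<close> with \<open>jordan_chevalley B S N\<close> exists and is unique, so quantifying
  over it refers to the Jordan-Chevalley decomposition of \<open>B\<close>.\<close>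

definition poincare_dulac_nf :: "'n::finite vfield \<Rightarrow> bool" where
  "poincare_dulac_nf f \<longleftrightarrow>
    (\<forall>S N. jordan_chevalley (linear_part f) S N \<longrightarrow> lie_bracket (linear_vfield S) f = 0)"

end

theory Submission
  imports Defs "HOL-Computational_Algebra.Fundamental_Theorem_Algebra"
begin

text \<open>Write \<open>f(x) = A x + \<dots>\<close> and let \<open>S\<close> be the semisimple part of \<open>A\<close>. On polynomials and on polynomial
  vector fields, the operators \<open>X_S\<close> and \<open>[S, \<cdot>]\<close> are locally diagonalizable, because products of
  eigenvectors of a derivation are eigenvectors, and the operators of the nilpotent part are locally
  nilpotent. Hence, in every degree, \<open>X_A = X_S + X_N\<close> is invertible on the image of \<open>X_S\<close>, and
  \<open>[A, \<cdot>]\<close> is injective on the image of \<open>[S, \<cdot>]\<close>.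

  Solving degree by degree, every series is a first integral of \<open>S\<close> plus an element of the image of
  \<open>X_f\<close>; since \<open>[g - \<beta> f, f] = (\<lambda> + X_f \<beta>) f\<close>, this gives \<open>\<beta>\<close>. For (b), \<open>y = [S, h]\<close> satisfies
  \<open>[f, y] = 0\<close>, and its lowest-degree part lies in the image of \<open>[S, \<cdot>]\<close>, so \<open>y = 0\<close>.
  The linear parts then satisfy \<open>A C - C A = \<alpha>_0 A\<close> with \<open>S\<close> and \<open>C\<close> commuting, which forces
  \<open>\<alpha>_0 = 0\<close> or \<open>S = 0\<close>. For (c), the same splitting for \<open>X_h\<close> inside the kernel of \<open>X_S\<close> yields
  \<open>\<alpha> = \<alpha>* + X_h w\<close>, and \<open>\<sigma> = exp (- w)\<close> works.\<close>

subsection \<open>Sums of commuting diagonalizable and nilpotent operators\<close>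

locale operator_space = vector_space scale
  for scale :: "'a::field \<Rightarrow> 'b::ab_group_add \<Rightarrow> 'b" (infixr "*s" 75)
begin

definition eigenspan :: "('b \<Rightarrow> 'b) \<Rightarrow> 'b set" where
  "eigenspan L = span {v. \<exists>\<mu>. L v = \<mu> *s v}"

primrec shift_prod :: "('b \<Rightarrow> 'b) \<Rightarrow> 'a list \<Rightarrow> 'b \<Rightarrow> 'b" where
  "shift_prod L [] v = v"
| "shift_prod L (\<mu> # \<mu>s) v = L (shift_prod L \<mu>s v) - \<mu> *s shift_prod L \<mu>s v"

text \<open>The polynomial \<open>t \<Prod>(t - \<mu>)\<close>, of which \<open>0\<close> is only a simple root, kills \<open>v\<close> under \<open>L\<close>. Unlike the
  eigenspace decomposition, this restricts to every \<open>L\<close>-invariant subspace without further work.\<close>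

definition annihilated :: "('b \<Rightarrow> 'b) \<Rightarrow> 'b \<Rightarrow> bool" where
  "annihilated L v \<longleftrightarrow> (\<exists>\<mu>s. 0 \<notin> set \<mu>s \<and> shift_prod L \<mu>s (L v) = 0)"

section \<open>Vectors killed by a polynomial with at most a simple root at 0\<close>

lemma shift_prod_append: "shift_prod L (xs @ ys) v = shift_prod L xs (shift_prod L ys v)"
  by (induction xs) auto

lemma shift_prod_commute:
  assumes "module_hom scale scale M" and "\<And>v. M (L v) = L (M v)"
  shows "M (shift_prod L xs v) = shift_prod L xs (M v)"
proof -
  interpret M: module_hom scale scale M by fact
  show ?thesis by (induction xs) (auto simp: M.diff M.scale assms(2))
qed

lemma module_hom_shift_prod:
  assumes "module_hom scale scale L"
  shows "module_hom scale scale (shift_prod L xs)"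
proof -
  interpret L: module_hom scale scale L by fact
  have "shift_prod L xs (u + v) = shift_prod L xs u + shift_prod L xs v"
    and "shift_prod L xs (c *s v) = c *s shift_prod L xs v" for u v c
    by (induction xs)
      (auto simp: L.add L.scale scale_right_distrib scale_right_diff_distrib mult.commute)
  then show ?thesis by unfold_locales auto
qed

text \<open>Polynomials in \<open>L\<close> commute, so the product of the two lists of shifts,
  followed by a single factor \<open>L\<close>, kills both summands.\<close>

lemma annihilated_add:
  assumes L: "module_hom scale scale L" and "annihilated L u" "annihilated L v"
  shows "annihilated L (u + v)"
proof -
  interpret L: module_hom scale scale L by fact
  obtain xs ys where x: "0 \<notin> set xs" "shift_prod L xs (L u) = 0"
    and y: "0 \<notin> set ys" "shift_prod L ys (L v) = 0"
    using assms unfolding annihilated_def by auto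
  interpret X: module_hom scale scale "shift_prod L xs" by (rule module_hom_shift_prod) fact
  interpret Y: module_hom scale scale "shift_prod L ys" by (rule module_hom_shift_prod) fact
  have "shift_prod L xs (shift_prod L ys (L u)) = shift_prod L ys (shift_prod L xs (L u))"
    by (metis L Y.module_hom_axioms shift_prod_commute)
  then have "shift_prod L (xs @ ys) (L (u + v)) = 0"
    by (simp add: shift_prod_append L.add X.add Y.add x y X.zero Y.zero)
  with x y show ?thesis unfolding annihilated_def by (metis Un_iff set_append)
qed

text \<open>An eigenvector for 0 is killed by \<open>L\<close> alone, any other one by
  \<open>L\<close> and a single shift; sums are handled by \<open>annihilated_add\<close>.\<close>

lemma eigenspan_annihilated:
  assumes L: "module_hom scale scale L" and "v \<in> eigenspan L"
  shows "annihilated L v"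
proof -
  interpret L: module_hom scale scale L by fact
  show ?thesis
    using assms(2) unfolding eigenspan_def
  proof (induction rule: span_induct_alt)
    case base
    show ?case unfolding annihilated_def by (rule exI[of _ "[]"]) (simp add: L.zero)
  next
    case (step c x y)
    then obtain \<mu> where \<mu>: "L x = \<mu> *s x" by auto
    have "shift_prod L (if \<mu> = 0 then [] else [\<mu>]) (L (c *s x)) = 0"
      by (auto simp: L.scale \<mu> mult.commute mult.left_commute)
    then have "annihilated L (c *s x)"
      unfolding annihilated_def by (metis empty_iff empty_set set_ConsD)
    then show ?case using step annihilated_add[OF L] by blast
  qed
qed

lemma annihilated_image:
  assumes L: "module_hom scale scale L" and "annihilated L v"
  shows "annihilated L (L v)"
proof -
  interpret L: module_hom scale scale L by fact
  show ?thesis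
    using assms unfolding annihilated_def by (metis L.zero shift_prod_commute)
qed

text \<open>If \<open>L\<close> kills \<open>L v\<close>, each shift by \<mu> acts on multiples of
  \<open>L v\<close> as the nonzero scalar -\<mu>, so the shifts can kill \<open>L v\<close> only if
  it is already 0.\<close>

lemma annihilated_square_zero:
  assumes L: "module_hom scale scale L" and "annihilated L v" "L (L v) = 0"
  shows "L v = 0"
proof -
  interpret L: module_hom scale scale L by fact
  obtain xs where x: "0 \<notin> set xs" "shift_prod L xs (L v) = 0"
    using assms unfolding annihilated_def by auto
  have L0: "L (shift_prod L ys (L v)) = 0" for ys
    by (metis L L.zero assms(3) module_hom.zero module_hom_shift_prod shift_prod_commute)
  show ?thesis
    using x by (induction xs) (auto simp: L0)
qed

lemma annihilated_funpow_zero: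
  assumes L: "module_hom scale scale L" and "annihilated L v" "(L ^^ k) v = 0"
  shows "L v = 0"
proof -
  interpret L: module_hom scale scale L by fact
  show ?thesis
    using assms(2,3)
  proof (induction k arbitrary: v)
    case (Suc k)
    then have "L (L v) = 0"
      using annihilated_image[OF L] by (metis comp_apply funpow_Suc_right)
    then show ?case using annihilated_square_zero[OF L] Suc by blast
  qed (simp add: L.zero)
qed

text \<open>Here \<open>L v = - N v\<close>, and the operators commute, so powers of
  \<open>L\<close> and \<open>N\<close> agree on \<open>v\<close> up to sign. Nilpotency of
  \<open>N\<close> at \<open>v\<close> thus passes to \<open>L\<close>, and an annihilated vector
  killed by a power of \<open>L\<close> is killed by \<open>L\<close>.\<close>

lemma annihilated_kernel_sum:
  assumes L: "module_hom scale scale L" and N: "module_hom scale scale N"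
    and comm: "\<And>v. L (N v) = N (L v)"
    and "annihilated L v" "(N ^^ k) v = 0" "L v + N v = 0"
  shows "L v = 0"
proof -
  interpret L: module_hom scale scale L by fact
  interpret N: module_hom scale scale N by fact
  have NL: "(N ^^ j) (L u) = L ((N ^^ j) u)" for j u
    by (induction j) (auto simp: comm)
  have Lv: "L v = - N v" using assms(6) by (simp add: eq_neg_iff_add_eq_0)
  have "(L ^^ j) v = (N ^^ j) v \<or> (L ^^ j) v = - (N ^^ j) v" for j
  proof (induction j)
    case (Suc j)
    have "L ((N ^^ j) v) = - N ((N ^^ j) v)"
    proof -
      have "L ((N ^^ j) v) = (N ^^ j) (- N v)" using NL Lv by metis
      also have "\<dots> = - (N ^^ j) (N v)" by (induction j) (auto simp: N.neg)
      finally show ?thesis by (simp add: funpow_swap1)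
    qed
    with Suc show ?case by (auto simp: L.neg)
  qed auto
  then have "(L ^^ k) v = 0" using assms(5) by (metis neg_equal_0_iff_equal)
  then show ?thesis using annihilated_funpow_zero[OF L] assms(4) by blast
qed

text \<open>Write the product of the t - \<mu> as c + t r(t), where c is nonzero because no \<mu> is
  0. Then \<open>shift_prod L xs v\<close> is c v plus an element of the image of \<open>L\<close>,
  and it lies in the kernel of \<open>L\<close>; dividing by c gives the splitting. Polynomials in
  \<open>L\<close> preserve \<open>K\<close>.\<close>

lemma annihilated_split:
  assumes L: "module_hom scale scale L" and K: "subspace K" "\<And>v. v \<in> K \<Longrightarrow> L v \<in> K"
    and "annihilated L v" "v \<in> K"
  shows "\<exists>u\<in>K. \<exists>w\<in>K. v = u + L w \<and> L u = 0"
proof -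
  interpret L: module_hom scale scale L by fact
  obtain xs where x: "0 \<notin> set xs" "shift_prod L xs (L v) = 0"
    using assms unfolding annihilated_def by auto
  have in_K: "shift_prod L ys v \<in> K" for ys
    using assms(5) by (induction ys) (auto intro!: subspace_diff subspace_scale K)
  have "0 \<notin> set ys \<Longrightarrow> \<exists>c. c \<noteq> 0 \<and> (\<exists>w\<in>K. shift_prod L ys v = c *s v + L w)" for ys
  proof (induction ys)
    case Nil
    show ?case by (intro exI[of _ 1] conjI bexI[of _ 0]) (auto simp: L.zero subspace_0 K)
  next
    case (Cons \<mu> ys)
    then obtain c w where c: "c \<noteq> 0" "w \<in> K" "shift_prod L ys v = c *s v + L w" by auto
    have "shift_prod L (\<mu> # ys) v = (- \<mu> * c) *s v + L (shift_prod L ys v - \<mu> *s w)"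
      by (simp add: L.diff L.scale c(3) scale_right_distrib algebra_simps)
    moreover have "shift_prod L ys v - \<mu> *s w \<in> K"
      by (intro subspace_diff subspace_scale K in_K c)
    moreover have "- \<mu> * c \<noteq> 0" using c Cons(2) by auto
    ultimately show ?case by blast
  qed
  from this[OF x(1)] obtain c w where c: "c \<noteq> 0" "w \<in> K" "shift_prod L xs v = c *s v + L w"
    by auto
  have "L (shift_prod L xs v) = 0" using x(2) shift_prod_commute[OF L] by metis
  moreover have "v = (1 / c) *s shift_prod L xs v + L (- (1 / c) *s w)"
    using c by (simp add: L.scale L.neg scale_right_distrib)
  moreover have "(1 / c) *s shift_prod L xs v \<in> K" "- (1 / c) *s w \<in> K"
    by (intro subspace_scale K in_K c)+
  ultimately show ?thesis by (metis L.scale scale_zero_right)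
qed

text \<open>Induction on the nilpotency exponent at \<open>v\<close>: if \<open>v = u + L w\<close>,
  then \<open>v = u + (L w + N w) - N w\<close>, and \<open>N w\<close> has a smaller
  exponent.\<close>

lemma annihilated_split_sum:
  assumes L: "module_hom scale scale L" and N: "module_hom scale scale N"
    and comm: "\<And>v. L (N v) = N (L v)"
    and K: "subspace K" "\<And>v. v \<in> K \<Longrightarrow> L v \<in> K" "\<And>v. v \<in> K \<Longrightarrow> N v \<in> K"
    and ann: "\<And>v. v \<in> K \<Longrightarrow> annihilated L v"
    and "v \<in> K" "(N ^^ k) v = 0"
  shows "\<exists>u\<in>K. \<exists>w\<in>K. v = u + (L w + N w) \<and> L u = 0"
  using assms(8,9)
proof (induction k arbitrary: v)
  interpret L: module_hom scale scale L by fact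
  interpret N: module_hom scale scale N by fact
  case 0
  then show ?case using subspace_0[OF K(1)]
    by (intro bexI[of _ 0]) (auto simp: L.zero N.zero)
next
  interpret L: module_hom scale scale L by fact
  interpret N: module_hom scale scale N by fact
  case (Suc k)
  have NL: "(N ^^ j) (L u) = L ((N ^^ j) u)" for j u
    by (induction j) (auto simp: comm)
  \<comment> \<open>Splitting inside this kernel ensures that \<open>w\<close> is killed by the same
    power of \<open>N\<close> as \<open>v\<close>, so that \<open>N w\<close> falls under the
    induction hypothesis.\<close>
  define K' where "K' = K \<inter> {v. (N ^^ Suc k) v = 0}"
  have NN: "module_hom scale scale (N ^^ j)" for j
  proof -
    have "(N ^^ j) (u + v) = (N ^^ j) u + (N ^^ j) v" "(N ^^ j) (c *s v) = c *s (N ^^ j) v" for u v c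
      by (induction j) (auto simp: N.add N.scale)
    then show ?thesis by unfold_locales auto
  qed
  have "subspace {v. (N ^^ Suc k) v = 0}"
    by (rule module_hom.subspace_kernel[OF NN])
  then have sK': "subspace K'" unfolding K'_def using K(1) by (rule subspace_inter[rotated])
  have "\<exists>u\<in>K'. \<exists>w\<in>K'. v = u + L w \<and> L u = 0"
  proof (rule annihilated_split[OF L sK'])
    show "L v \<in> K'" if "v \<in> K'" for v
      using that K(2) unfolding K'_def by (auto simp del: funpow.simps simp: NL L.zero)
  qed (use Suc ann in \<open>auto simp: K'_def\<close>)
  then obtain u w where uw: "u \<in> K'" "w \<in> K'" "v = u + L w" "L u = 0" by auto
  have "N w \<in> K" "(N ^^ k) (N w) = 0"
    using uw K(3) by (auto simp: K'_def funpow_swap1)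
  from Suc.IH[OF this] obtain u' w' where *: "u' \<in> K" "w' \<in> K" "N w = u' + (L w' + N w')" "L u' = 0"
    by auto
  have "v = (u - u') + (L (w - w') + N (w - w'))"
  proof -
    have "v = u + (L w + N w) - N w" by (simp add: uw(3))
    also have "\<dots> = u + (L w + N w) - (u' + (L w' + N w'))" using *(3) by simp
    finally show ?thesis by (simp add: L.diff N.diff algebra_simps)
  qed
  then show ?case using uw * K(1)
    by (intro bexI[of _ "u - u'"] bexI[of _ "w - w'"]) (auto simp: K'_def L.diff intro: subspace_diff)
qed

text \<open>Replacing \<open>v\<close> by \<open>U v\<close> or by \<open>V v\<close> lowers one of
  the two exponents by one, which matches the one application of the sum used up; once an exponent
  is 0, the vector is 0. This replaces a binomial expansion.\<close>

lemma nilpotent_add_commuting: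
  assumes U: "module_hom scale scale U" and V: "module_hom scale scale V"
    and comm: "\<And>v. U (V v) = V (U v)"
    and "(U ^^ a) v = 0" "(V ^^ b) v = 0" "a + b \<le> n"
  shows "((\<lambda>v. U v + V v) ^^ n) v = 0"
  using assms(4-6)
proof (induction n arbitrary: a b v)
  case (Suc n)
  interpret U: module_hom scale scale U by fact
  interpret V: module_hom scale scale V by fact
  let ?W = "\<lambda>v. U v + V v"
  have W0: "(?W ^^ j) 0 = 0" for j by (induction j) (auto simp: U.zero V.zero)
  have Wadd: "(?W ^^ j) (u + v) = (?W ^^ j) u + (?W ^^ j) v" for j u v
    by (induction j) (auto simp: U.add V.add algebra_simps)
  have VU: "(V ^^ j) (U u) = U ((V ^^ j) u)" for j u by (induction j) (auto simp: comm)
  have UV: "(U ^^ j) (V u) = V ((U ^^ j) u)" for j u by (induction j) (auto simp: comm)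
  show ?case
  proof (cases "a = 0 \<or> b = 0")
    case True
    then have "v = 0" using Suc by auto
    then show ?thesis using W0 by metis
  next
    case False
    then obtain a' b' where ab: "a = Suc a'" "b = Suc b'" by (metis not0_implies_Suc)
    have a: "(U ^^ a') (U v) = 0" "(V ^^ b) (U v) = 0" and b: "(U ^^ a) (V v) = 0" "(V ^^ b') (V v) = 0"
      using Suc(2,3) by (simp_all only: VU UV U.zero V.zero) (simp_all add: ab funpow_swap1)
    have "(?W ^^ n) (U v) = 0"
      using Suc(4) ab by (intro Suc.IH[OF a]) auto
    moreover have "(?W ^^ n) (V v) = 0"
      using Suc(4) ab by (intro Suc.IH[OF b]) auto
    ultimately show ?thesis by (simp add: funpow_Suc_right Wadd del: funpow.simps)
  qed
qed simp

end

subsection \<open>Semisimple matrices\<close>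

text \<open>This is the vector p(S) u, computed by Horner's scheme on vectors.\<close>

definition orbit_comb :: "complex ^ 'n ^ 'n \<Rightarrow> complex ^ 'n \<Rightarrow> complex poly \<Rightarrow> complex ^ 'n::finite" where
  "orbit_comb S u p = fold_coeffs (\<lambda>a v. a *s u + S *v v) p 0"

lemma orbit_comb_0 [simp]: "orbit_comb S u 0 = 0"
  by (simp add: orbit_comb_def)

lemma orbit_comb_pCons [simp]: "orbit_comb S u (pCons a p) = a *s u + S *v orbit_comb S u p"
  by (cases "a = 0"; cases "p = 0")
    (simp_all add: orbit_comb_def)

lemma orbit_comb_add: "orbit_comb S u (p + q) = orbit_comb S u p + orbit_comb S u q"
  by (induction p q rule: poly_induct2)
    (auto simp: vec.scale_left_distrib matrix_vector_right_distrib algebra_simps)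

lemma orbit_comb_smult: "orbit_comb S u (smult c p) = c *s orbit_comb S u p"
  by (induction p) (auto simp: vec.scale_right_distrib vector_scalar_commute)

lemma orbit_comb_linear_factor:
  "orbit_comb S u ([:-\<mu>, 1:] * q) = S *v orbit_comb S u q - \<mu> *s orbit_comb S u q"
proof -
  have "[:-\<mu>, 1:] * q = smult (- \<mu>) q + pCons 0 q" by simp
  then show ?thesis by (simp only: orbit_comb_add orbit_comb_smult orbit_comb_pCons) simp
qed

lemma orbit_comb_in_subspace:
  assumes "vec.subspace U" "\<And>u. u \<in> U \<Longrightarrow> S *v u \<in> U" "u \<in> U"
  shows "orbit_comb S u p \<in> U"
  by (induction p) (auto intro!: vec.subspace_add vec.subspace_scale vec.subspace_0 assms)

text \<open>Some power S^k u depends linearly on the earlier ones, since otherwise there would be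
  more than \<open>CARD('n)\<close> independent vectors. The dependence is a polynomial with leading
  coefficient 1 in degree k.\<close>

lemma orbit_comb_annihilator_exists:
  fixes u :: "complex ^ 'n::finite"
  shows "\<exists>p. p \<noteq> 0 \<and> orbit_comb S u p = 0"
proof -
  define x where "x k = orbit_comb S u (monom 1 k)" for k
  have "\<exists>k. x k \<in> vec.span (x ` {..<k})"
  proof (rule ccontr)
    assume no: "\<not> ?thesis"
    have "vec.independent (x ` {..<k}) \<and> card (x ` {..<k}) = k" for k
    proof (induction k)
      case (Suc k)
      have "x k \<notin> vec.span (x ` {..<k})" using no by blast
      moreover from this have "x k \<notin> x ` {..<k}" by (metis vec.span_base)
      ultimately show ?case using Suc by (simp add: lessThan_Suc vec.independent_insert)
    qed (simp add: vec.independent_empty)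
    then have "Suc CARD('n) \<le> vec.dim (UNIV :: (complex ^ 'n) set)"
      by (metis vec.independent_card_le_dim subset_UNIV)
    then show False by (simp only: vec_dim_card)
  qed
  then obtain k where k: "x k \<in> vec.span (x ` {..<k})" by auto
  \<comment> \<open>The bound is put on the coefficients and not on \<open>degree\<close>, so that
    for k = 0 only the zero polynomial qualifies.\<close>
  let ?R = "{orbit_comb S u q | q. \<forall>i\<ge>k. coeff q i = 0}"
  have "vec.span (x ` {..<k}) \<subseteq> ?R"
  proof (rule vec.span_minimal)
    show "x ` {..<k} \<subseteq> ?R"
    proof
      fix y assume "y \<in> x ` {..<k}"
      then obtain i where "i < k" "y = orbit_comb S u (monom 1 i)" by (auto simp: x_def)
      then show "y \<in> ?R" by (intro CollectI exI[of _ "monom 1 i"]) auto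
    qed
    show "vec.subspace ?R"
    proof (rule vec.subspaceI)
      show "0 \<in> ?R" by (intro CollectI exI[of _ 0]) simp
    next
      fix v w assume "v \<in> ?R" "w \<in> ?R"
      then obtain p q where "v = orbit_comb S u p" "\<forall>i\<ge>k. coeff p i = 0"
        "w = orbit_comb S u q" "\<forall>i\<ge>k. coeff q i = 0" by blast
      then show "v + w \<in> ?R"
        by (intro CollectI exI[of _ "p + q"]) (simp add: orbit_comb_add)
    next
      fix c v assume "v \<in> ?R"
      then obtain p where "v = orbit_comb S u p" "\<forall>i\<ge>k. coeff p i = 0" by blast
      then show "c *s v \<in> ?R"
        by (intro CollectI exI[of _ "smult c p"]) (simp add: orbit_comb_smult)
    qed
  qed
  with k obtain q where q: "x k = orbit_comb S u q" "\<forall>i\<ge>k. coeff q i = 0" by blast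
  have "coeff (monom 1 k + smult (-1) q) k = 1" using q by simp
  then have "monom 1 k + smult (-1) q \<noteq> 0" by (metis coeff_0 zero_neq_one)
  moreover have "orbit_comb S u (monom 1 k + smult (-1) q) = 0"
    by (simp only: orbit_comb_add orbit_comb_smult q(1)[unfolded x_def]) simp
  ultimately show ?thesis by blast
qed

text \<open>Take p of least degree with p(S) u = 0 and a complex root \<mu> of it. With p = (t -
  \<mu>) q, the vector q(S) u is nonzero by minimality and is an eigenvector for \<mu>.\<close>

lemma invariant_subspace_eigenvector:
  fixes S :: "complex ^ 'n::finite ^ 'n"
  assumes U: "vec.subspace U" "\<And>u. u \<in> U \<Longrightarrow> S *v u \<in> U" and "u \<in> U" "u \<noteq> 0"
  shows "\<exists>v\<in>U. v \<noteq> 0 \<and> (\<exists>\<mu>. S *v v = \<mu> *s v)"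
proof -
  obtain p where p: "p \<noteq> 0" "orbit_comb S u p = 0"
    and min: "\<And>q. q \<noteq> 0 \<Longrightarrow> orbit_comb S u q = 0 \<Longrightarrow> degree p \<le> degree q"
    using ex_has_least_nat[of "\<lambda>p. p \<noteq> 0 \<and> orbit_comb S u p = 0" _ degree]
      orbit_comb_annihilator_exists[of S u] by metis
  have "degree p \<noteq> 0"
  proof
    assume "degree p = 0"
    then obtain a where "p = [:a:]" by (rule degree_eq_zeroE)
    with p assms(4) show False by simp
  qed
  then obtain \<mu> where "poly p \<mu> = 0"
    using fundamental_theorem_of_algebra[of p] by (auto simp: constant_degree)
  then obtain q where q: "p = [:-\<mu>, 1:] * q" by (auto simp: poly_eq_0_iff_dvd)
  have "q \<noteq> 0" using p q by auto
  then have "degree q < degree p"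
    unfolding q by (subst degree_mult_eq) auto
  with min \<open>q \<noteq> 0\<close> have "orbit_comb S u q \<noteq> 0" by fastforce
  moreover have "S *v orbit_comb S u q = \<mu> *s orbit_comb S u q"
    using p(2) unfolding q orbit_comb_linear_factor by simp
  moreover have "orbit_comb S u q \<in> U" using U assms(3) by (rule orbit_comb_in_subspace)
  ultimately show ?thesis by blast
qed

section \<open>Diagonalization of semisimple matrices\<close>

definition diag_matrix :: "'a::zero ^ 'n \<Rightarrow> 'a ^ 'n ^ 'n" where
  "diag_matrix d = (\<chi> i j. if i = j then d $ i else 0)"

lemma diag_matrix_mult_vec: "diag_matrix d *v x = (\<chi> i. d $ i * x $ i)"
  by (simp add: vec_eq_iff diag_matrix_def matrix_vector_mult_def if_distrib[of "\<lambda>t. t * _"] cong: if_cong)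

text \<open>The span of the eigenvectors is invariant and so has an invariant complement. A nonzero
  complement would contain an eigenvector, which would lie in both subspaces.\<close>

lemma semisimple_eigenvectors_span:
  fixes S :: "complex ^ 'n::finite ^ 'n"
  assumes "semisimple_matrix S"
  shows "vec.span {v. \<exists>\<mu>. S *v v = \<mu> *s v} = UNIV"
proof -
  let ?E = "{v. \<exists>\<mu>. S *v v = \<mu> *s v}"
  let ?W = "vec.span ?E"
  have "S *v w \<in> ?W" if "w \<in> ?W" for w
    using that
  proof (induction rule: vec.span_induct_alt)
    case (step c x y)
    then obtain \<mu> where \<mu>: "S *v x = \<mu> *s x" by auto
    have "S *v (c *s x + y) = (c * \<mu>) *s x + S *v y"
      by (simp add: matrix_vector_right_distrib vector_scalar_commute \<mu>)
    moreover have "(c * \<mu>) *s x + S *v y \<in> ?W"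
      by (intro vec.span_add vec.span_scale vec.span_base step)
    ultimately show ?case by simp
  qed (simp add: vec.span_zero)
  then have "vec.subspace ?W \<and> (\<forall>w\<in>?W. S *v w \<in> ?W)" by (simp add: vec.subspace_span)
  then have "\<exists>U. vec.subspace U \<and> (\<forall>u\<in>U. S *v u \<in> U) \<and> ?W \<inter> U = {0} \<and>
      (\<forall>v. \<exists>w\<in>?W. \<exists>u\<in>U. v = w + u)"
    by (rule assms[unfolded semisimple_matrix_def, THEN spec, THEN mp])
  then obtain U where U: "vec.subspace U" "\<And>u. u \<in> U \<Longrightarrow> S *v u \<in> U" "?W \<inter> U = {0}"
    and sum: "\<And>v. \<exists>w\<in>?W. \<exists>u\<in>U. v = w + u" by auto
  have U0: "u = 0" if "u \<in> U" for u
    using invariant_subspace_eigenvector[OF U(1,2) that] U(3) vec.span_base[of _ ?E] by fastforce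
  show ?thesis
  proof (intro equalityI subset_UNIV subsetI)
    fix v
    obtain w u where "w \<in> ?W" "u \<in> U" "v = w + u" using sum by blast
    moreover from this have "u = 0" by (intro U0)
    ultimately show "v \<in> ?W" by simp
  qed
qed

text \<open>The columns of \<open>P\<close> are a basis of eigenvectors chosen from the spanning
  set.\<close>

lemma semisimple_diagonalizable:
  fixes S :: "complex ^ 'n::finite ^ 'n"
  assumes "semisimple_matrix S"
  obtains P Q :: "complex ^ 'n ^ 'n" and d where "P ** Q = mat 1" "Q ** P = mat 1" "S = P ** diag_matrix d ** Q"
proof -
  let ?E = "{v. \<exists>\<mu>. S *v v = \<mu> *s v}"
  obtain B where B: "B \<subseteq> ?E" "vec.independent B" "?E \<subseteq> vec.span B"
    by (rule vec.maximal_independent_subset)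
  have span: "vec.span B = UNIV"
    using semisimple_eigenvectors_span[OF assms] vec.span_minimal[OF B(3) vec.subspace_span] by auto
  then have "card B = CARD('n)"
    using vec.dim_eq_card[of B UNIV] B(2) vec_dim_card by (metis vec.span_UNIV)
  moreover have "finite B" using B(2) by (rule vec.finiteI_independent)
  ultimately obtain b where b: "bij_betw b (UNIV :: 'n set) B"
    using finite_same_card_bij[of "UNIV :: 'n set" B] by auto
  define P where "P = (\<chi> i j. b j $ i)"
  have col: "column j P = b j" for j by (simp add: P_def column_def vec_eq_iff)
  have "columns P = B" using b by (auto simp: columns_def col bij_betw_def)
  then obtain Q where PQ: "P ** Q = mat 1"
    using matrix_right_invertible_span_columns[of P] span by auto
  then have QP: "Q ** P = mat 1" by (simp add: matrix_left_right_inverse)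
  have "\<forall>j. \<exists>\<mu>. S *v b j = \<mu> *s b j" using b B(1) by (auto simp: bij_betw_def)
  then obtain \<mu> where \<mu>: "S *v b j = \<mu> j *s b j" for j by metis
  have "S ** P = P ** diag_matrix (\<chi> j. \<mu> j)"
  proof -
    have "(S ** P) $ i $ j = (P ** diag_matrix (\<chi> j. \<mu> j)) $ i $ j" for i j
    proof -
      have "(S ** P) $ i $ j = (S *v b j) $ i"
        by (simp add: matrix_matrix_mult_def matrix_vector_mult_def P_def)
      also have "\<dots> = b j $ i * \<mu> j" by (simp add: \<mu>)
      also have "\<dots> = (P ** diag_matrix (\<chi> j. \<mu> j)) $ i $ j"
        by (simp add: matrix_matrix_mult_def P_def diag_matrix_def if_distrib[of "\<lambda>t. _ * t"] cong: if_cong)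
      finally show ?thesis .
    qed
    then show ?thesis by (simp add: vec_eq_iff)
  qed
  then have "S = P ** diag_matrix (\<chi> j. \<mu> j) ** Q"
    by (metis PQ matrix_mul_assoc matrix_mul_rid)
  then show thesis using that[OF PQ QP] by blast
qed

section \<open>Kernels and commutators of semisimple and nilpotent matrices\<close>

lemma semisimple_square_kernel:
  fixes S :: "complex ^ 'n::finite ^ 'n"
  assumes "semisimple_matrix S" "S *v (S *v v) = 0"
  shows "S *v v = 0"
proof -
  obtain P Q :: "complex ^ 'n ^ 'n" and d where d: "P ** Q = mat 1" "Q ** P = mat 1" "S = P ** diag_matrix d ** Q"
    using semisimple_diagonalizable[OF assms(1)] .
  have S: "S *v x = P *v (diag_matrix d *v (Q *v x))" for x
    by (simp add: d(3) flip: matrix_vector_mul_assoc)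
  have QP: "Q *v (P *v x) = x" and PQ: "P *v (Q *v x) = x" for x
    by (simp_all add: matrix_vector_mul_assoc d)
  have "P *v (diag_matrix d *v (diag_matrix d *v (Q *v v))) = 0"
    using assms(2) unfolding S QP .
  then have "diag_matrix d *v (diag_matrix d *v (Q *v v)) = 0"
    by (metis QP matrix_vector_mult_0_right)
  \<comment> \<open>In each coordinate, d_i^2 x_i = 0 forces d_i x_i = 0.\<close>
  then have "diag_matrix d *v (Q *v v) = 0"
    by (auto simp: diag_matrix_mult_vec vec_eq_iff)
  then show ?thesis by (simp add: S)
qed

text \<open>From S v = - N v one gets S N^(k+1) v = - S^2 N^k v, so the vanishing of S N^k v
  descends to k = 0 by \<open>semisimple_square_kernel\<close>. It is applied to the constant term
  of a normalizing field.\<close>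

lemma semisimple_nilpotent_sum_kernel:
  fixes S N :: "complex ^ 'n::finite ^ 'n"
  assumes "semisimple_matrix S" "nilpotent_matrix N" "S ** N = N ** S" "(S + N) *v v = 0"
  shows "S *v v = 0"
proof -
  obtain k where k: "(((**) N) ^^ k) (mat 1) = 0" using assms(2) unfolding nilpotent_matrix_def by auto
  have pow: "(((**) N) ^^ j) (mat 1) *v v = ((*v) N ^^ j) v" for j
    by (induction j) (simp_all flip: matrix_vector_mul_assoc)
  have eq: "S *v v = - (N *v v)"
    using assms(4) by (simp add: matrix_vector_mult_add_rdistrib eq_neg_iff_add_eq_0)
  have comm: "S *v (N *v x) = N *v (S *v x)" for x
    using assms(3) by (simp add: matrix_vector_mul_assoc)
  have NS: "((*v) N ^^ j) (S *v x) = S *v ((*v) N ^^ j) x" for j x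
    by (induction j) (auto simp: comm)
  have "((*v) N ^^ k) v = 0" using k pow by (metis matrix_vector_mult_0)
  then have "S *v ((*v) N ^^ k) v = 0" by simp
  then show ?thesis
  proof (induction k)
    case (Suc k)
    have "((*v) N ^^ Suc k) v = ((*v) N ^^ k) (- (S *v v))"
      by (simp add: eq funpow_swap1)
    also have "\<dots> = - ((*v) N ^^ k) (S *v v)"
      by (induction k) (auto simp: vec.neg)
    also have "\<dots> = - (S *v (((*v) N ^^ k) v))" by (simp add: NS)
    finally have "S *v (S *v (((*v) N ^^ k) v)) = 0" using Suc(2) by (simp add: vec.neg)
    then show ?case using semisimple_square_kernel[OF assms(1)] Suc by blast
  qed simp
qed

text \<open>If \<open>S N^(k+1) = 0\<close>, then expanding \<open>S (N^(k+1) C - C N^(k+1))\<close> gives \<open>S^2 N^k = 0\<close>, hence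
  \<open>S N^k = 0\<close> by semisimplicity; one descends to \<open>k = 0\<close>.\<close>

lemma semisimple_zero_of_scaled_commutator:
  fixes S N C :: "complex ^ 'n::finite ^ 'n"
  assumes S: "semisimple_matrix S" and N: "nilpotent_matrix N" and SN: "S ** N = N ** S"
    and SC: "S ** C = C ** S"
    and c: "\<And>v. N *v (C *v v) - C *v (N *v v) = c *s (S *v v + N *v v)" "c \<noteq> 0"
  shows "S = 0"
proof -
  let ?N = "\<lambda>k. (*v) N ^^ k"
  obtain k where k: "(((**) N) ^^ k) (mat 1) = 0" using N unfolding nilpotent_matrix_def by auto
  have pow: "(((**) N) ^^ j) (mat 1) *v v = ?N j v" for j v
    by (induction j) (simp_all flip: matrix_vector_mul_assoc)
  have Nk: "S *v ?N k v = 0" for v by (metis k matrix_vector_mult_0 matrix_vector_mult_0_right pow)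
  have NS: "?N j (S *v v) = S *v ?N j v" for j v
    by (induction j) (auto simp: matrix_vector_mul_assoc SN)
  have CS: "C *v (S *v v) = S *v (C *v v)" for v
    by (simp add: matrix_vector_mul_assoc SC)
  have add: "?N j (u + v) = ?N j u + ?N j v" and scale: "?N j (a *s u) = a *s ?N j u" for j u v a
    by (induction j) (auto simp: matrix_vector_right_distrib vector_scalar_commute)
  \<comment> \<open>For j = 0 the index j - 1 is truncated to 0, but the factor
    \<open>of_nat j\<close> removes that term.\<close>
  have comm: "?N j (C *v v) = C *v ?N j v + (of_nat j * c) *s (S *v ?N (j - 1) v + ?N j v)" for j v
  proof (induction j)
    case (Suc j)
    have "?N (Suc j) (C *v v) = N *v (C *v ?N j v) + (of_nat j * c) *s (S *v (N *v ?N (j - 1) v) + ?N (Suc j) v)"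
      by (simp add: Suc matrix_vector_right_distrib vector_scalar_commute) (simp add: matrix_vector_mul_assoc SN)
    also have "(of_nat j * c) *s (S *v (N *v ?N (j - 1) v) + ?N (Suc j) v) =
      (of_nat j * c) *s (S *v ?N j v + ?N (Suc j) v)"
      by (cases j) auto
    also have "N *v (C *v ?N j v) = C *v ?N (Suc j) v + c *s (S *v ?N j v + ?N (Suc j) v)"
      using c(1)[of "?N j v"] by (simp add: algebra_simps)
    finally show ?case by (simp add: vec.scale_left_distrib algebra_simps)
  qed simp
  from Nk have "S *v v = 0" for v
  proof (induction k arbitrary: v)
    case (Suc k)
    have "S *v (S *v ?N k v) = 0" for v
    proof -
      have "S *v (C *v ?N (Suc k) v) = 0" using Suc.prems CS by (metis matrix_vector_mult_0_right)
      moreover have "S *v ?N (Suc k) (C *v v) = S *v (C *v ?N (Suc k) v)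
          + (of_nat (Suc k) * c) *s (S *v (S *v ?N k v) + S *v ?N (Suc k) v)"
        by (subst comm) (simp add: matrix_vector_right_distrib vector_scalar_commute)
      ultimately have "(of_nat (Suc k) * c) *s (S *v (S *v ?N k v)) = 0"
        using Suc.prems by simp
      then show "S *v (S *v ?N k v) = 0"
        using c(2) by (simp add: vec.scale_eq_0_iff del: of_nat_Suc)
    qed
    then have "S *v ?N k v = 0" for v using semisimple_square_kernel[OF S] by blast
    then show ?case by (rule Suc.IH)
  qed simp
  then show ?thesis by (simp add: matrix_eq)
qed

subsection \<open>Derivations of power series\<close>

definition mdeg :: "nat ^ 'n::finite \<Rightarrow> nat" where
  "mdeg m = (\<Sum>i\<in>UNIV. m $ i)"

lemma mdeg_add [simp]: "mdeg (a + b) = mdeg a + mdeg b"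
  by (simp add: mdeg_def sum.distrib)

lemma mdeg_axis [simp]: "mdeg (axis i k) = k"
  by (simp add: mdeg_def axis_def if_distrib cong: if_cong)

lemma mdeg_eq_0_iff [simp]: "mdeg m = 0 \<longleftrightarrow> m = 0"
  by (auto simp: mdeg_def vec_eq_iff)

lemma component_le_mdeg: "m $ i \<le> mdeg m"
  unfolding mdeg_def by (rule member_le_sum) auto

lemma finite_mdeg_le: "finite {m :: nat ^ 'n::finite. mdeg m \<le> k}"
proof (rule finite_subset[OF _ finite_exponents_le[of "\<chi> i. k"]])
  show "{m :: nat ^ 'n. mdeg m \<le> k} \<subseteq> {a. \<forall>i. a $ i \<le> (\<chi> i. k) $ i}"
    using component_le_mdeg order_trans by fastforce
qed

lemma exponent_split_axis:
  fixes m :: "nat ^ 'n::finite"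
  assumes "m $ i \<noteq> 0"
  obtains a where "m = a + axis i 1"
proof
  show "m = (\<chi> j. m $ j - axis i 1 $ j) + axis i 1"
    using assms by (auto simp: vec_eq_iff axis_def)
qed

lemma exponent_nonzero_split_axis:
  fixes m :: "nat ^ 'n::finite"
  assumes "m \<noteq> 0"
  obtains a i where "m = a + axis i 1"
  using assms exponent_split_axis by (metis vec_eq_iff zero_index)

section \<open>Coefficients, products and partial derivatives\<close>

lemma mfps_coeff_const: "mfps_coeff (mfps_const c) m = (if m = 0 then c else 0)"
  by (simp add: mfps_const_def)

lemma mfps_coeff_var: "mfps_coeff (mfps_var i) m = (if m = axis i 1 then 1 else 0)"
  by (simp add: mfps_var_def)

lemma mfps_coeff_pderiv:
  "mfps_coeff (pderiv_mfps i p) m = of_nat (m $ i + 1) * mfps_coeff p (m + axis i 1)"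
  by (simp add: pderiv_mfps_def)

lemma mfps_coeff_sum [simp]:
  "mfps_coeff (\<Sum>x\<in>A. f x) m = (\<Sum>x\<in>A. mfps_coeff (f x) m :: 'a::comm_ring_1)"
  by (induction A rule: infinite_finite_induct) auto

lemma mfps_coeff_const_mult [simp]:
  fixes p :: "('a::comm_ring_1, 'n::finite) mfps"
  shows "mfps_coeff (mfps_const c * p) m = c * mfps_coeff p m"
proof -
  have "mfps_coeff (mfps_const c * p) m = (\<Sum>(a, b)\<in>{(0, m)}. mfps_coeff (mfps_const c :: ('a, 'n) mfps) a * mfps_coeff p b)"
    unfolding mfps_coeff_mult
    by (rule sum.mono_neutral_right) (auto simp: mfps_coeff_const split: if_splits)
  then show ?thesis by (simp add: mfps_coeff_const)
qed

lemma mfps_coeff_var_mult: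
  fixes p :: "('a::comm_ring_1, 'n::finite) mfps"
  shows "mfps_coeff (mfps_var i * p) (m + axis i 1) = mfps_coeff p m"
proof -
  have "mfps_coeff (mfps_var i * p) (m + axis i 1) =
      (\<Sum>(a, b)\<in>{(axis i 1, m)}. mfps_coeff (mfps_var i :: ('a, 'n) mfps) a * mfps_coeff p b)"
    unfolding mfps_coeff_mult
    by (rule sum.mono_neutral_right) (auto simp: mfps_coeff_var add.commute split: if_splits)
  then show ?thesis by (simp add: mfps_coeff_var)
qed

lemma mfps_coeff_mult_0:
  fixes p :: "('a::comm_ring_1, 'n::finite) mfps"
  shows "mfps_coeff (p * q) 0 = mfps_coeff p 0 * mfps_coeff q 0"
proof -
  have "splits (0 :: nat ^ 'n) = {(0, 0)}" by (auto simp: splits_def vec_eq_iff)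
  then show ?thesis by (simp add: mfps_coeff_mult)
qed

lemma mfps_const_0 [simp]: "mfps_const 0 = 0"
  and mfps_const_1 [simp]: "mfps_const 1 = 1"
  by (auto intro!: mfps_eqI simp: mfps_coeff_const mfps_coeff_1)

lemma mfps_const_add: "mfps_const (a + b) = mfps_const a + mfps_const (b :: 'a::comm_ring_1)"
  and mfps_const_mult: "mfps_const (a * b) = mfps_const a * mfps_const (b :: 'a::comm_ring_1)"
  by (auto intro!: mfps_eqI simp: mfps_coeff_const)

lemma pderiv_mfps_add: "pderiv_mfps i (p + q) = pderiv_mfps i p + pderiv_mfps i q"
  and pderiv_mfps_diff: "pderiv_mfps i (p - q) = pderiv_mfps i p - pderiv_mfps i (q :: ('a::comm_ring_1, 'n::finite) mfps)"
  by (auto intro!: mfps_eqI simp: mfps_coeff_pderiv algebra_simps)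

lemma pderiv_mfps_const [simp]: "pderiv_mfps i (mfps_const c) = (0 :: ('a::comm_ring_1, 'n::finite) mfps)"
  by (rule mfps_eqI) (auto simp: mfps_coeff_pderiv mfps_coeff_const vec_eq_iff axis_def)

lemma pderiv_mfps_commute:
  "pderiv_mfps i (pderiv_mfps j p) = pderiv_mfps j (pderiv_mfps i (p :: ('a::comm_ring_1, 'n::finite) mfps))"
  by (rule mfps_eqI) (auto simp: mfps_coeff_pderiv axis_def add_ac mult_ac)

lemma pderiv_mfps_var: "pderiv_mfps i (mfps_var j) = (if i = j then 1 else 0 :: ('a::comm_ring_1, 'n::finite) mfps)"
proof (rule mfps_eqI)
  fix m :: "nat ^ 'n"
  have "m + axis i 1 = axis j 1 \<longleftrightarrow> i = j \<and> m = 0"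
  proof
    assume eq: "m + axis i 1 = axis j 1"
    then have "mdeg m + 1 = 1" by (metis mdeg_add mdeg_axis)
    then have "m = 0" by simp
    with eq show "i = j \<and> m = 0" by (auto simp: axis_eq_axis)
  qed auto
  then show "mfps_coeff (pderiv_mfps i (mfps_var j)) m = mfps_coeff (if i = j then 1 else 0 :: ('a, 'n) mfps) m"
    by (auto simp: mfps_coeff_pderiv mfps_coeff_var mfps_coeff_1)
qed

text \<open>The reindexing behind the Leibniz rule: every split of the raised exponent whose first
  part contains the variable i comes from a unique split of \<open>m\<close>, and the other splits
  contribute 0.\<close>

lemma sum_splits_shift:
  fixes F :: "nat ^ 'n::finite \<Rightarrow> nat ^ 'n \<Rightarrow> 'a::comm_monoid_add"
  assumes "\<And>a b. a $ i = 0 \<Longrightarrow> F a b = 0"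
  shows "(\<Sum>(a, b)\<in>splits (m + axis i 1). F a b) = (\<Sum>(a, b)\<in>splits m. F (a + axis i 1) b)"
proof -
  have "(\<Sum>(a, b)\<in>splits (m + axis i 1). F a b) =
    (\<Sum>(a, b)\<in>(\<lambda>(a, b). (a + axis i 1, b)) ` splits m. F a b)"
  proof (rule sum.mono_neutral_right)
    show "\<forall>x\<in>splits (m + axis i 1) - (\<lambda>(a, b). (a + axis i 1, b)) ` splits m. (case x of (a, b) \<Rightarrow> F a b) = 0"
    proof clarify
      fix a b assume *: "(a, b) \<in> splits (m + axis i 1)"
        "(a, b) \<notin> (\<lambda>(a, b). (a + axis i 1, b)) ` splits m"
      show "F a b = 0"
      proof (rule ccontr)
        assume "F a b \<noteq> 0"
        then obtain c where c: "a = c + axis i 1" using assms exponent_split_axis by metis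
        then have "c + b + axis i 1 = m + axis i 1" using *(1) by (simp add: add_ac)
        then have "c + b = m" by (rule add_right_imp_eq)
        with *(2) c show False by force
      qed
    qed
  qed (auto simp: add_ac)
  also have "\<dots> = (\<Sum>(a, b)\<in>splits m. F (a + axis i 1) b)"
    by (subst sum.reindex) (auto simp: inj_on_def case_prod_unfold)
  finally show ?thesis .
qed

text \<open>The factor \<open>m $ i + 1\<close> is the sum of the i-th exponents of the two
  monomials being multiplied. Each of the two resulting sums is a shifted Cauchy product, the second
  after exchanging the factors.\<close>

lemma pderiv_mfps_mult:
  fixes p q :: "('a::comm_ring_1, 'n::finite) mfps"
  shows "pderiv_mfps i (p * q) = pderiv_mfps i p * q + p * pderiv_mfps i q"
proof (rule mfps_eqI)
  have half: "mfps_coeff (pderiv_mfps i p * q) m =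
    (\<Sum>(a, b)\<in>splits (m + axis i 1). of_nat (a $ i) * mfps_coeff p a * mfps_coeff q b)"
    for p q :: "('a, 'n) mfps" and m
    by (subst sum_splits_shift) (auto simp: mfps_coeff_mult mfps_coeff_pderiv)
  fix m
  have "mfps_coeff (pderiv_mfps i (p * q)) m =
    (\<Sum>(a, b)\<in>splits (m + axis i 1). of_nat (m $ i + 1) * (mfps_coeff p a * mfps_coeff q b))"
    by (simp add: mfps_coeff_pderiv mfps_coeff_mult sum_distrib_left case_prod_unfold)
  also have "\<dots> = (\<Sum>(a, b)\<in>splits (m + axis i 1). of_nat (a $ i) * mfps_coeff p a * mfps_coeff q b
      + of_nat (b $ i) * mfps_coeff p a * mfps_coeff q b)"
  proof (rule sum.cong[OF refl], clarify)
    fix a b assume "(a, b) \<in> splits (m + axis i 1)"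
    then have "m $ i + 1 = a $ i + b $ i" by (auto simp: vec_eq_iff axis_def split: if_splits)
    then show "of_nat (m $ i + 1) * (mfps_coeff p a * mfps_coeff q b) =
      of_nat (a $ i) * mfps_coeff p a * mfps_coeff q b + of_nat (b $ i) * mfps_coeff p a * mfps_coeff q b"
      by (metis distrib_right mult.assoc of_nat_add)
  qed
  also have "\<dots> = mfps_coeff (pderiv_mfps i p * q) m +
    (\<Sum>(a, b)\<in>splits (m + axis i 1). of_nat (b $ i) * mfps_coeff p a * mfps_coeff q b)"
    by (simp add: half sum.distrib case_prod_unfold)
  also have "(\<Sum>(a, b)\<in>splits (m + axis i 1). of_nat (b $ i) * mfps_coeff p a * mfps_coeff q b) =
    mfps_coeff (pderiv_mfps i q * p) m"
    unfolding half
    by (rule sum.reindex_bij_witness[where i = prod.swap and j = prod.swap]) (auto simp: add_ac mult_ac)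
  finally show "mfps_coeff (pderiv_mfps i (p * q)) m = mfps_coeff (pderiv_mfps i p * q + p * pderiv_mfps i q) m"
    by (simp add: mult.commute)
qed

section \<open>Lie derivatives and Lie brackets\<close>

lemma lie_deriv_add: "lie_deriv g (p + q) = lie_deriv g p + lie_deriv g q"
  and lie_deriv_diff: "lie_deriv g (p - q) = lie_deriv g p - lie_deriv g q"
  and lie_deriv_mult: "lie_deriv g (p * q) = lie_deriv g p * q + p * lie_deriv g q"
  by (simp_all add: lie_deriv_def pderiv_mfps_add pderiv_mfps_diff pderiv_mfps_mult algebra_simps sum.distrib
      sum_subtractf sum_distrib_left)

lemma lie_deriv_const [simp]: "lie_deriv g (mfps_const c) = 0"
  by (simp add: lie_deriv_def)

lemma lie_deriv_0 [simp]: "lie_deriv g 0 = 0" and lie_deriv_1 [simp]: "lie_deriv g 1 = 0"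
  using lie_deriv_const[of g 0] lie_deriv_const[of g 1] by simp_all

lemma lie_deriv_uminus: "lie_deriv g (- p) = - lie_deriv g p"
  using lie_deriv_diff[of g 0 p] by simp

lemma lie_deriv_const_mult: "lie_deriv g (mfps_const c * p) = mfps_const c * lie_deriv g p"
  by (simp add: lie_deriv_mult)

lemma lie_deriv_sum: "lie_deriv g (\<Sum>x\<in>A. f x) = (\<Sum>x\<in>A. lie_deriv g (f x))"
  by (induction A rule: infinite_finite_induct) (auto simp: lie_deriv_add)

lemma lie_deriv_field_add: "lie_deriv (g + h) p = lie_deriv g p + lie_deriv h p"
  and lie_deriv_field_diff: "lie_deriv (g - h) p = lie_deriv g p - lie_deriv h p"
  and lie_deriv_field_scale: "lie_deriv (\<sigma> *s g) p = \<sigma> * lie_deriv g p"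
  by (simp_all add: lie_deriv_def algebra_simps sum.distrib sum_subtractf sum_distrib_left)

lemma lie_bracket_component: "lie_bracket g h $ i = lie_deriv g (h $ i) - lie_deriv h (g $ i)"
  by (simp add: lie_bracket_def jacobian_mfps_def matrix_vector_mult_def lie_deriv_def)

text \<open>The second-order terms are symmetric in \<open>g\<close> and \<open>h\<close> because
  partial derivatives commute, so they cancel in the commutator. The Jacobi identity follows by
  applying this to components.\<close>

lemma lie_deriv_lie_bracket:
  "lie_deriv (lie_bracket g h) p = lie_deriv g (lie_deriv h p) - lie_deriv h (lie_deriv g p)"
proof -
  have XX: "lie_deriv g (lie_deriv h p) = (\<Sum>j\<in>UNIV. \<Sum>k\<in>UNIV. pderiv_mfps k (pderiv_mfps j p) * (h $ j * g $ k)) +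
    (\<Sum>j\<in>UNIV. pderiv_mfps j p * lie_deriv g (h $ j))" for g h :: "'a vfield"
    unfolding lie_deriv_def[of h p] lie_deriv_sum lie_deriv_mult sum.distrib
    by (simp add: lie_deriv_def[of g "pderiv_mfps _ p"] sum_distrib_right sum_distrib_left mult_ac)
  have "(\<Sum>j\<in>UNIV. \<Sum>k\<in>UNIV. pderiv_mfps k (pderiv_mfps j p) * (h $ j * g $ k)) =
    (\<Sum>j\<in>UNIV. \<Sum>k\<in>UNIV. pderiv_mfps k (pderiv_mfps j p) * (g $ j * h $ k))"
    by (subst sum.swap) (simp add: pderiv_mfps_commute mult_ac)
  then show ?thesis
    unfolding XX by (simp add: lie_deriv_def[of "lie_bracket g h"] lie_bracket_component right_diff_distrib sum_subtractf)
qed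

lemma lie_bracket_jacobi:
  "lie_bracket (lie_bracket g h) k = lie_bracket g (lie_bracket h k) - lie_bracket h (lie_bracket g k)"
  by (simp add: vec_eq_iff lie_bracket_component lie_deriv_lie_bracket lie_deriv_diff)

lemma lie_bracket_commute: "lie_bracket g h = - lie_bracket h g"
  by (simp add: vec_eq_iff lie_bracket_component)

lemma lie_bracket_add_right: "lie_bracket g (h + k) = lie_bracket g h + lie_bracket g k"
  and lie_bracket_add_left: "lie_bracket (h + k) g = lie_bracket h g + lie_bracket k g"
  and lie_bracket_diff_left: "lie_bracket (h - k) g = lie_bracket h g - lie_bracket k g"
  and lie_bracket_scale_right: "lie_bracket g (\<sigma> *s h) = lie_deriv g \<sigma> *s h + \<sigma> *s lie_bracket g h"
  and lie_bracket_scale_left: "lie_bracket (\<sigma> *s h) g = \<sigma> *s lie_bracket h g - lie_deriv g \<sigma> *s h"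
  by (simp_all add: vec_eq_iff lie_bracket_component lie_deriv_add lie_deriv_diff lie_deriv_mult
      lie_deriv_field_add lie_deriv_field_diff lie_deriv_field_scale algebra_simps)

lemma lie_bracket_zero_right [simp]: "lie_bracket g 0 = 0" and lie_bracket_self: "lie_bracket g g = 0"
  by (simp_all add: vec_eq_iff lie_bracket_component) (simp add: lie_deriv_def)

subsection \<open>Spectra of linear vector fields\<close>

interpretation ser: operator_space "\<lambda>c (p :: 'n::finite series). mfps_const c * p"
  by unfold_locales (simp_all add: mfps_const_add mfps_const_mult algebra_simps)

interpretation vf: operator_space "\<lambda>c (g :: 'n::finite vfield). mfps_const c *s g"
  by unfold_locales (simp_all add: vec_eq_iff mfps_const_add mfps_const_mult algebra_simps)

lemma lie_deriv_module_hom: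
  "module_hom (\<lambda>c p. mfps_const c * p) (\<lambda>c p. mfps_const c * p) (lie_deriv g)"
  by (simp add: module_hom_iff ser.module_axioms lie_deriv_add lie_deriv_const_mult)

lemma lie_bracket_module_hom:
  "module_hom (\<lambda>c h. mfps_const c *s h) (\<lambda>c h. mfps_const c *s h) (lie_bracket g)"
  by (simp add: module_hom_iff vf.module_axioms lie_bracket_add_right lie_bracket_scale_right)

lemma mfps_coeff_var_mult_eq_0:
  fixes p :: "('a::comm_ring_1, 'n::finite) mfps"
  assumes "m $ i = 0"
  shows "mfps_coeff (mfps_var i * p) m = 0"
  unfolding mfps_coeff_mult using assms
  by (intro sum.neutral) (auto simp: mfps_coeff_var)

text \<open>Polynomials are generated as a ring by constants and variables; a monomial is reached by
  splitting off one variable at a time. Spectral claims about derivations then need checking only on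
  generators.\<close>

lemma mfps_finite_support_induct [consumes 1, case_names const var add mult]:
  fixes p :: "('a::comm_ring_1, 'n::finite) mfps"
  assumes fin: "finite {m. mfps_coeff p m \<noteq> 0}"
    and const: "\<And>c. R (mfps_const c)" and var: "\<And>i. R (mfps_var i)"
    and add: "\<And>p q. R p \<Longrightarrow> R q \<Longrightarrow> R (p + q)" and mult: "\<And>p q. R p \<Longrightarrow> R q \<Longrightarrow> R (p * q)"
  shows "R p"
proof -
  define mono where "mono c m = Mfps (\<lambda>k. if k = m then c else 0)" for c :: 'a and m :: "nat ^ 'n"
  have R_mono: "R (mono c m)" for c m
  proof (induction "mdeg m" arbitrary: m)
    case 0
    then have "mono c m = mfps_const c" by (simp add: mono_def mfps_const_def)
    then show ?case using const by simp
  next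
    case (Suc d)
    then have "m \<noteq> 0" by (metis mdeg_eq_0_iff nat.distinct(1))
    then obtain a i where m: "m = a + axis i 1" by (rule exponent_nonzero_split_axis)
    have "mono c m = mfps_var i * mono c a"
    proof (rule mfps_eqI)
      fix k
      show "mfps_coeff (mono c m) k = mfps_coeff (mfps_var i * mono c a) k"
      proof (cases "k $ i = 0")
        case True
        then have "k \<noteq> m" by (auto simp: m axis_def)
        then show ?thesis using mfps_coeff_var_mult_eq_0[OF True] by (simp add: mono_def)
      next
        case False
        then obtain b where k: "k = b + axis i 1" by (rule exponent_split_axis)
        show ?thesis unfolding k mfps_coeff_var_mult by (simp add: mono_def m)
      qed
    qed
    moreover have "R (mono c a)" using Suc m by (intro Suc(1)) simp
    ultimately show ?case using mult var by simp
  qed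
  have R_sum: "R (\<Sum>x\<in>A. f x)" if "\<And>x. R (f x)" "finite A" for A :: "(nat ^ 'n) set" and f
    using that(2) by (induction A) (use that(1) const[of 0] in \<open>auto intro: add\<close>)
  have "p = (\<Sum>m | mfps_coeff p m \<noteq> 0. mono (mfps_coeff p m) m)"
    by (rule mfps_eqI) (use fin in \<open>auto simp: mono_def\<close>)
  then show ?thesis using R_sum[OF R_mono fin] by metis
qed

text \<open>Letting the matrix act on an arbitrary field, and not only on the coordinate field as in
  \<open>linear_vfield\<close>, makes successive actions compose to a matrix product.\<close>

definition cmat :: "complex ^ 'n ^ 'n \<Rightarrow> 'n::finite vfield \<Rightarrow> 'n vfield" where
  "cmat B g = (\<chi> i j. mfps_const (B $ i $ j)) *v g"

lemma cmat_component: "cmat B g $ i = (\<Sum>j\<in>UNIV. mfps_const (B $ i $ j) * g $ j)"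
  by (simp add: cmat_def matrix_vector_mult_def)

lemma linear_vfield_cmat: "linear_vfield B = cmat B (\<chi> j. mfps_var j)"
  by (simp add: linear_vfield_def cmat_def)

lemma mfps_const_uminus: "mfps_const (- c) = - mfps_const (c :: 'a::comm_ring_1)"
  by (rule mfps_eqI) (simp add: mfps_coeff_const)

lemma mfps_const_sum: "mfps_const (\<Sum>x\<in>A. f x) = (\<Sum>x\<in>A. mfps_const (f x :: 'a::comm_ring_1))"
  by (induction A rule: infinite_finite_induct) (auto simp: mfps_const_add)

lemma cmat_cmat: "cmat B (cmat C g) = cmat (B ** C) g"
proof -
  have "cmat B (cmat C g) $ i = cmat (B ** C) g $ i" for i
  proof -
    have "cmat B (cmat C g) $ i =
      (\<Sum>j\<in>UNIV. \<Sum>k\<in>UNIV. mfps_const (B $ i $ j) * mfps_const (C $ j $ k) * g $ k)"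
      by (simp add: cmat_component sum_distrib_left mult.assoc)
    also have "\<dots> = (\<Sum>k\<in>UNIV. \<Sum>j\<in>UNIV. mfps_const (B $ i $ j) * mfps_const (C $ j $ k) * g $ k)"
      by (rule sum.swap)
    also have "\<dots> = cmat (B ** C) g $ i"
      by (simp add: cmat_component matrix_matrix_mult_def mfps_const_sum mfps_const_mult sum_distrib_right)
    finally show ?thesis .
  qed
  then show ?thesis by (simp add: vec_eq_iff)
qed

lemma cmat_mat_1 [simp]: "cmat (mat 1) g = g"
  by (simp add: vec_eq_iff cmat_component mat_def if_distrib[of mfps_const] if_distrib[of "\<lambda>t. t * _"] cong: if_cong)

lemma cmat_0 [simp]: "cmat 0 g = 0"
  by (simp add: vec_eq_iff cmat_component)

lemma cmat_add_left: "cmat (B + C) g = cmat B g + cmat C g"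
  by (simp add: vec_eq_iff cmat_component mfps_const_add distrib_right sum.distrib)

lemma cmat_add_right: "cmat B (g + h) = cmat B g + cmat B h"
  and cmat_uminus_right: "cmat B (- g) = - cmat B g"
  and cmat_scale_right: "cmat B (\<sigma> *s g) = \<sigma> *s cmat B g"
  by (simp_all add: vec_eq_iff cmat_component algebra_simps sum.distrib sum_distrib_left sum_negf)

lemma cmat_diag_matrix_component: "cmat (diag_matrix d) g $ i = mfps_const (d $ i) * g $ i"
  by (simp add: cmat_component diag_matrix_def if_distrib[of mfps_const] if_distrib[of "\<lambda>t. t * _"] cong: if_cong)

lemma linear_vfield_0 [simp]: "linear_vfield 0 = 0"
  by (simp add: linear_vfield_cmat)

lemma linear_vfield_add: "linear_vfield (B + C) = linear_vfield B + linear_vfield C"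
  by (simp add: linear_vfield_cmat cmat_add_left)

lemma lie_deriv_var: "lie_deriv g (mfps_var i) = g $ i"
  by (simp add: lie_deriv_def pderiv_mfps_var if_distrib[of "\<lambda>t. t * _"] cong: if_cong)

lemma lie_deriv_cmat: "lie_deriv g (cmat B h $ i) = cmat B (\<chi> j. lie_deriv g (h $ j)) $ i"
  by (simp add: cmat_component lie_deriv_sum lie_deriv_const_mult)

lemma lie_deriv_linear_vfield: "lie_deriv g (linear_vfield B $ i) = cmat B g $ i"
  by (simp add: linear_vfield_cmat lie_deriv_cmat lie_deriv_var)

lemma lie_bracket_linear_component:
  "lie_bracket (linear_vfield B) h $ i = lie_deriv (linear_vfield B) (h $ i) - cmat B h $ i"
  by (simp add: lie_bracket_component lie_deriv_linear_vfield)

lemma lie_bracket_linear_linear: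
  "lie_bracket (linear_vfield B) (linear_vfield C) = linear_vfield (C ** B) - linear_vfield (B ** C)"
  by (simp add: vec_eq_iff lie_bracket_component lie_deriv_linear_vfield)
    (simp add: linear_vfield_cmat cmat_cmat)

text \<open>By the Leibniz rule, a product of eigenvectors for \<mu> and \<nu> is an eigenvector for
  \<mu> + \<nu>. The two inductions extend this to spans, one factor at a time.\<close>

lemma eigenspan_lie_deriv_mult:
  assumes "p \<in> ser.eigenspan (lie_deriv g)" "q \<in> ser.eigenspan (lie_deriv g)"
  shows "p * q \<in> ser.eigenspan (lie_deriv g)"
proof -
  let ?E = "ser.eigenspan (lie_deriv g)"
  have *: "x * q \<in> ?E" if x: "lie_deriv g x = mfps_const \<mu> * x" for x \<mu>
    using assms(2) unfolding ser.eigenspan_def[of "lie_deriv g"]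
  proof (induction rule: ser.span_induct_alt)
    case base
    show ?case by (simp add: ser.span_zero)
  next
    case (step c y z)
    then obtain \<nu> where "lie_deriv g y = mfps_const \<nu> * y" by auto
    then have "lie_deriv g (x * y) = mfps_const (\<mu> + \<nu>) * (x * y)"
      by (simp add: lie_deriv_mult x mfps_const_add algebra_simps)
    then have "x * y \<in> ser.span {v. \<exists>\<mu>. lie_deriv g v = mfps_const \<mu> * v}"
      by (intro ser.span_base) blast
    then have "mfps_const c * (x * y) + x * z \<in> ser.span {v. \<exists>\<mu>. lie_deriv g v = mfps_const \<mu> * v}"
      using step by (intro ser.span_add ser.span_scale)
    then show ?case by (simp add: algebra_simps)
  qed
  show ?thesis
    using assms(1) unfolding ser.eigenspan_def[of "lie_deriv g"]
  proof (induction rule: ser.span_induct_alt)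
    case base
    show ?case by (simp add: ser.span_zero)
  next
    case (step c y z)
    then obtain \<nu> where "lie_deriv g y = mfps_const \<nu> * y" by auto
    then have "mfps_const c * (y * q) + z * q \<in> ser.span {v. \<exists>\<mu>. lie_deriv g v = mfps_const \<mu> * v}"
      using step *[of y \<nu>] unfolding ser.eigenspan_def by (intro ser.span_add ser.span_scale)
    then show ?case by (simp add: algebra_simps)
  qed
qed

text \<open>The linear forms (Q x)_i are eigenvectors for the entries d_i, and \<open>P\<close>
  expresses the variables through them; products and sums give all polynomials.\<close>

lemma semisimple_lie_deriv_eigenspan:
  assumes S: "semisimple_matrix S" and p: "finite {m. mfps_coeff p m \<noteq> 0}"
  shows "p \<in> ser.eigenspan (lie_deriv (linear_vfield S))"
proof -
  obtain P Q :: "complex ^ 'a ^ 'a" and d where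
    PQ: "P ** Q = mat 1" "Q ** P = mat 1" and d: "S = P ** diag_matrix d ** Q"
    using semisimple_diagonalizable[OF S] .
  let ?E = "ser.eigenspan (lie_deriv (linear_vfield S))"
  have QS: "Q ** S = diag_matrix d ** Q"
    by (simp add: d matrix_mul_assoc PQ matrix_mul_lid)
  have "lie_deriv (linear_vfield S) (linear_vfield Q $ i) = mfps_const (d $ i) * linear_vfield Q $ i" for i
  proof -
    have "lie_deriv (linear_vfield S) (linear_vfield Q $ i) = cmat (Q ** S) (\<chi> j. mfps_var j) $ i"
      by (simp add: lie_deriv_linear_vfield linear_vfield_cmat[of S] cmat_cmat)
    then show ?thesis
      by (simp add: QS cmat_diag_matrix_component linear_vfield_cmat flip: cmat_cmat)
  qed
  then have Q: "linear_vfield Q $ i \<in> ?E" for i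
    unfolding ser.eigenspan_def by (intro ser.span_base) auto
  show ?thesis
    using p
  proof (induction rule: mfps_finite_support_induct)
    case (const c)
    have "lie_deriv (linear_vfield S) (mfps_const c) = mfps_const 0 * mfps_const c" by simp
    then show ?case unfolding ser.eigenspan_def by (intro ser.span_base) blast
  next
    case (var i)
    have "mfps_var i = cmat P (linear_vfield Q) $ i"
      by (simp add: linear_vfield_cmat cmat_cmat PQ)
    then show ?case
      using Q unfolding cmat_component ser.eigenspan_def by (auto intro!: ser.span_sum ser.span_scale)
  next
    case (add p q)
    then show ?case unfolding ser.eigenspan_def by (rule ser.span_add)
  next
    case (mult p q)
    then show ?case by (rule eigenspan_lie_deriv_mult)
  qed
qed

text \<open>The columns v_i of \<open>P\<close>, as constant fields, are eigenvectors for -d_i. An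
  eigenfunction for \<nu> times v_i is therefore an eigenvector for \<nu> - d_i, and
  \<open>h\<close> is the sum of the (Q h)_i v_i.\<close>

lemma semisimple_lie_bracket_eigenspan:
  fixes S :: "complex ^ 'n::finite ^ 'n"
  assumes S: "semisimple_matrix S" and h: "\<And>i. finite {m. mfps_coeff (h $ i) m \<noteq> 0}"
  shows "h \<in> vf.eigenspan (lie_bracket (linear_vfield S))"
proof -
  obtain P Q :: "complex ^ 'n ^ 'n" and d where
    PQ: "P ** Q = mat 1" "Q ** P = mat 1" and d: "S = P ** diag_matrix d ** Q"
    using semisimple_diagonalizable[OF S] .
  let ?E = "vf.eigenspan (lie_bracket (linear_vfield S))"
  define v :: "'n \<Rightarrow> 'n vfield" where "v i = (\<chi> k. mfps_const (P $ k $ i))" for i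
  have SP: "S ** P = P ** diag_matrix d"
    by (metis d PQ(2) matrix_mul_assoc matrix_mul_rid)
  have bracket_v: "lie_bracket (linear_vfield S) (v i) = mfps_const (- (d $ i)) *s v i" for i
  proof -
    have "cmat S (v i) $ k = mfps_const ((S ** P) $ k $ i)" for k
      by (simp add: cmat_component v_def matrix_matrix_mult_def mfps_const_sum mfps_const_mult)
    also have "mfps_const ((S ** P) $ k $ i) = mfps_const (d $ i) * v i $ k" for k
      unfolding SP
      by (simp add: v_def matrix_matrix_mult_def diag_matrix_def mfps_const_mult mult.commute
        if_distrib[of "\<lambda>t. _ * t"] if_distrib[of "\<lambda>t. t * _"] cong: if_cong)
    finally have "cmat S (v i) $ k = mfps_const (d $ i) * v i $ k" for k .
    then show ?thesis
      by (simp add: vec_eq_iff lie_bracket_linear_component mfps_const_uminus) (simp add: v_def)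
  qed
  have v: "p *s v i \<in> ?E" if "p \<in> ser.eigenspan (lie_deriv (linear_vfield S))" for p i
    using that unfolding ser.eigenspan_def
  proof (induction rule: ser.span_induct_alt)
    case base
    show ?case by (simp add: vf.eigenspan_def vf.span_zero)
  next
    case (step c y z)
    then obtain \<nu> where "lie_deriv (linear_vfield S) y = mfps_const \<nu> * y" by auto
    then have "lie_bracket (linear_vfield S) (y *s v i) = mfps_const (\<nu> + - d $ i) *s (y *s v i)"
      by (simp only: lie_bracket_scale_right bracket_v mfps_const_add mfps_const_uminus)
        (simp add: vec_eq_iff algebra_simps)
    then have "y *s v i \<in> ?E"
      unfolding vf.eigenspan_def by (intro vf.span_base) blast
    then have "mfps_const c *s (y *s v i) + z *s v i \<in> ?E"
      using step unfolding vf.eigenspan_def by (intro vf.span_add vf.span_scale)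
    then show ?case by (simp add: vec_eq_iff algebra_simps)
  qed
  have "h = cmat P (cmat Q h)" by (simp add: cmat_cmat PQ)
  also have "\<dots> = (\<Sum>i\<in>UNIV. cmat Q h $ i *s v i)"
    by (simp add: vec_eq_iff cmat_component[of P] v_def mult.commute)
  also have "\<dots> \<in> ?E"
    unfolding vf.eigenspan_def
  proof (rule vf.span_sum)
    fix i
    have "cmat Q h $ i \<in> ser.eigenspan (lie_deriv (linear_vfield S))"
      unfolding cmat_component using semisimple_lie_deriv_eigenspan[OF S h]
      unfolding ser.eigenspan_def by (auto intro!: ser.span_sum ser.span_scale)
    then show "cmat Q h $ i *s v i \<in> vf.span {v. \<exists>\<mu>. lie_bracket (linear_vfield S) v = mfps_const \<mu> *s v}"
      using v unfolding vf.eigenspan_def by blast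
  qed
  finally show ?thesis .
qed

section \<open>Local nilpotency of nilpotent linear fields\<close>

lemma funpow_zero_mono:
  fixes D :: "'b::zero \<Rightarrow> 'b"
  assumes "D 0 = 0" "(D ^^ a) p = 0" "a \<le> b"
  shows "(D ^^ b) p = 0"
proof -
  have "(D ^^ c) 0 = 0" for c by (induction c) (auto simp: assms(1))
  moreover have "(D ^^ b) p = (D ^^ (b - a)) ((D ^^ a) p)"
    using assms(3) by (metis comp_apply funpow_add le_add_diff_inverse2)
  ultimately show ?thesis using assms(2) by simp
qed

lemma lie_deriv_funpow_add: "(lie_deriv g ^^ k) (p + q) = (lie_deriv g ^^ k) p + (lie_deriv g ^^ k) q"
  by (induction k) (auto simp: lie_deriv_add)

lemma lie_deriv_funpow_mult_zero:
  assumes "(lie_deriv g ^^ a) p = 0" "(lie_deriv g ^^ b) q = 0" "a + b \<le> n"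
  shows "(lie_deriv g ^^ n) (p * q) = 0"
  using assms
proof (induction n arbitrary: a b p q)
  case (Suc n)
  have zero: "(lie_deriv g ^^ j) 0 = 0" for j by (induction j) auto
  show ?case
  proof (cases "a = 0 \<or> b = 0")
    case True
    then have "p * q = 0" using Suc by auto
    then show ?thesis using zero by metis
  next
    case False
    then obtain a' b' where ab: "a = Suc a'" "b = Suc b'" by (metis not0_implies_Suc)
    have "(lie_deriv g ^^ n) (lie_deriv g p * q) = 0"
      using Suc.prems ab by (intro Suc.IH[of a' _ b]) (auto simp: funpow_swap1)
    moreover have "(lie_deriv g ^^ n) (p * lie_deriv g q) = 0"
      using Suc.prems ab by (intro Suc.IH[of a _ b']) (auto simp: funpow_swap1)
    ultimately show ?thesis
      by (simp add: funpow_Suc_right lie_deriv_mult lie_deriv_funpow_add del: funpow.simps)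
  qed
qed simp

lemma matrix_power_commute: "(((**) N) ^^ k) (mat 1) ** N = N ** (((**) N) ^^ k) (mat 1)"
  by (induction k) (simp_all add: matrix_mul_lid matrix_mul_rid flip: matrix_mul_assoc)

text \<open>Iterating on the variable x_i yields the i-th component of N^j x, which vanishes for
  large j; sums and products inherit the property.\<close>

lemma nilpotent_lie_deriv:
  assumes N: "nilpotent_matrix N" and p: "finite {m. mfps_coeff p m \<noteq> 0}"
  shows "\<exists>k. (lie_deriv (linear_vfield N) ^^ k) p = 0"
  using p
proof (induction rule: mfps_finite_support_induct)
  case (const c)
  have "(lie_deriv (linear_vfield N) ^^ 1) (mfps_const c) = 0" by simp
  then show ?case by blast
next
  case (var i)
  obtain k where k: "(((**) N) ^^ k) (mat 1) = 0" using N unfolding nilpotent_matrix_def by auto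
  have "(lie_deriv (linear_vfield N) ^^ j) (mfps_var i) =
    cmat ((((**) N) ^^ j) (mat 1)) (\<chi> j. mfps_var j) $ i" for j
  proof (induction j)
    case (Suc j)
    then show ?case
      by (simp add: lie_deriv_cmat lie_deriv_var)
        (simp add: linear_vfield_cmat cmat_cmat matrix_power_commute)
  qed simp
  with k have "(lie_deriv (linear_vfield N) ^^ k) (mfps_var i) = 0" by simp
  then show ?case by blast
next
  case (add p q)
  then obtain a b where "(lie_deriv (linear_vfield N) ^^ a) p = 0" "(lie_deriv (linear_vfield N) ^^ b) q = 0"
    by auto
  then have "(lie_deriv (linear_vfield N) ^^ (a + b)) (p + q) = 0"
    using funpow_zero_mono[of "lie_deriv (linear_vfield N)" a p "a + b"]
      funpow_zero_mono[of "lie_deriv (linear_vfield N)" b q "a + b"]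
    by (simp add: lie_deriv_funpow_add)
  then show ?case by blast
next
  case (mult p q)
  then show ?case using lie_deriv_funpow_mult_zero by blast
qed

text \<open>The bracket with \<open>N\<close> is the componentwise derivation minus multiplication
  by \<open>N\<close>. These commute and are each nilpotent at \<open>h\<close>, so
  \<open>nilpotent_add_commuting\<close> applies.\<close>

lemma nilpotent_lie_bracket:
  fixes N :: "complex ^ 'n::finite ^ 'n"
  assumes N: "nilpotent_matrix N" and h: "\<And>i. finite {m. mfps_coeff (h $ i) m \<noteq> 0}"
  shows "\<exists>k. (lie_bracket (linear_vfield N) ^^ k) h = 0"
proof -
  let ?U = "\<lambda>h :: 'n vfield. \<chi> i. lie_deriv (linear_vfield N) (h $ i)"
  let ?V = "\<lambda>h :: 'n vfield. - cmat N h"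
  obtain k where "\<And>i. (lie_deriv (linear_vfield N) ^^ k i) (h $ i) = 0"
    using nilpotent_lie_deriv[OF N h] by metis
  \<comment> \<open>The sum of the exponents of the components serves as a common exponent.\<close>
  moreover have "k i \<le> (\<Sum>i\<in>UNIV. k i)" for i by (rule member_le_sum) auto
  ultimately have "(lie_deriv (linear_vfield N) ^^ (\<Sum>i\<in>UNIV. k i)) (h $ i) = 0" for i
    using funpow_zero_mono[of "lie_deriv (linear_vfield N)", OF lie_deriv_0] by blast
  moreover have "(?U ^^ j) h $ i = (lie_deriv (linear_vfield N) ^^ j) (h $ i)" for i j
    by (induction j) auto
  ultimately have U: "(?U ^^ (\<Sum>i\<in>UNIV. k i)) h = 0" by (simp add: vec_eq_iff)
  obtain b where b: "(((**) N) ^^ b) (mat 1) = 0" using N unfolding nilpotent_matrix_def by auto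
  have "(?V ^^ j) h = cmat ((((**) N) ^^ j) (mat 1)) h \<or> (?V ^^ j) h = - cmat ((((**) N) ^^ j) (mat 1)) h" for j
    by (induction j) (auto simp: cmat_cmat cmat_uminus_right)
  from this[of b] have V: "(?V ^^ b) h = 0" by (auto simp: b)
  have "((\<lambda>h. ?U h + ?V h) ^^ ((\<Sum>i\<in>UNIV. k i) + b)) h = 0"
  proof (rule vf.nilpotent_add_commuting[OF _ _ _ U V order_refl])
    show "module_hom (\<lambda>c g. mfps_const c *s g) (\<lambda>c g. mfps_const c *s g) ?U"
      by (simp add: module_hom_iff vf.module_axioms vec_eq_iff lie_deriv_add lie_deriv_const_mult)
    show "module_hom (\<lambda>c g. mfps_const c *s g) (\<lambda>c g. mfps_const c *s g) ?V"
      by (simp add: module_hom_iff vf.module_axioms cmat_add_right cmat_scale_right)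
    show "?U (?V v) = ?V (?U v)" for v
      by (simp add: vec_eq_iff lie_deriv_cmat lie_deriv_uminus)
  qed
  moreover have "(\<lambda>h. ?U h + ?V h) = lie_bracket (linear_vfield N)"
    by (simp add: fun_eq_iff vec_eq_iff lie_bracket_linear_component)
  ultimately show ?thesis by metis
qed

subsection \<open>Homogeneous parts and orders\<close>

definition hom_part :: "nat \<Rightarrow> ('a::zero, 'n::finite) mfps \<Rightarrow> ('a, 'n) mfps" where
  "hom_part j p = Mfps (\<lambda>m. if mdeg m = j then mfps_coeff p m else 0)"

text \<open>As a lower bound this needs no value for the order of 0, which satisfies it for every
  \<open>j\<close>.\<close>

definition order_ge :: "nat \<Rightarrow> ('a::zero, 'n::finite) mfps \<Rightarrow> bool" where
  "order_ge j p \<longleftrightarrow> (\<forall>m. mdeg m < j \<longrightarrow> mfps_coeff p m = 0)"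

lemma mfps_coeff_hom_part: "mfps_coeff (hom_part j p) m = (if mdeg m = j then mfps_coeff p m else 0)"
  by (simp add: hom_part_def)

lemma hom_part_idem [simp]: "hom_part j (hom_part j p) = hom_part j p"
  by (rule mfps_eqI) (simp add: mfps_coeff_hom_part)

lemma hom_part_0 [simp]: "hom_part j (0 :: ('a::comm_ring_1, 'n::finite) mfps) = 0"
  by (rule mfps_eqI) (simp add: mfps_coeff_hom_part)

lemma hom_part_add: "hom_part j (p + q) = hom_part j p + hom_part j (q :: ('a::comm_ring_1, 'n::finite) mfps)"
  and hom_part_diff: "hom_part j (p - q) = hom_part j p - hom_part j (q :: ('a::comm_ring_1, 'n::finite) mfps)"
  and hom_part_const_mult: "hom_part j (mfps_const c * p) = mfps_const c * hom_part j (p :: ('a::comm_ring_1, 'n::finite) mfps)"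
  by (auto intro!: mfps_eqI simp: mfps_coeff_hom_part)

lemma hom_part_sum: "hom_part j (\<Sum>x\<in>A. f x) = (\<Sum>x\<in>A. hom_part j (f x :: ('a::comm_ring_1, 'n::finite) mfps))"
  by (induction A rule: infinite_finite_induct) (auto simp: hom_part_add)

lemma finite_support_hom_part: "finite {m. mfps_coeff (hom_part j p) m \<noteq> 0}"
  by (rule finite_subset[OF _ finite_mdeg_le[of j]]) (auto simp: mfps_coeff_hom_part)

lemma hom_part_pderiv: "hom_part j (pderiv_mfps i p) = pderiv_mfps i (hom_part (Suc j) p)"
  by (rule mfps_eqI) (simp add: mfps_coeff_hom_part mfps_coeff_pderiv)

lemma hom_part_ext: "(\<And>j. hom_part j p = hom_part j q) \<Longrightarrow> p = q"
  by (rule mfps_eqI) (metis mfps_coeff_hom_part)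

lemma order_ge_0 [simp]: "order_ge 0 p"
  by (simp add: order_ge_def)

lemma order_ge_mono: "order_ge b p \<Longrightarrow> a \<le> b \<Longrightarrow> order_ge a p"
  by (auto simp: order_ge_def)

lemma order_ge_diff: "order_ge a p \<Longrightarrow> order_ge a q \<Longrightarrow> order_ge a (p - q :: ('a::comm_ring_1, 'n::finite) mfps)"
  by (auto simp: order_ge_def)

lemma order_ge_sum:
  "(\<And>x. x \<in> A \<Longrightarrow> order_ge a (f x)) \<Longrightarrow> order_ge a (\<Sum>x\<in>A. f x :: ('a::comm_ring_1, 'n::finite) mfps)"
  by (auto simp: order_ge_def intro!: sum.neutral)

lemma order_ge_mult:
  fixes p q :: "('a::comm_ring_1, 'n::finite) mfps"
  assumes "order_ge a p" "order_ge b q"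
  shows "order_ge (a + b) (p * q)"
  unfolding order_ge_def
proof (intro allI impI)
  fix m :: "nat ^ 'n" assume m: "mdeg m < a + b"
  have "mfps_coeff p k * mfps_coeff q l = 0" if "k + l = m" for k l
  proof -
    have "mdeg k < a \<or> mdeg l < b" using m that by auto
    then show ?thesis using assms by (auto simp: order_ge_def)
  qed
  then show "mfps_coeff (p * q) m = 0"
    unfolding mfps_coeff_mult by (intro sum.neutral) auto
qed

lemma order_ge_pderiv: "order_ge a p \<Longrightarrow> order_ge (a - 1) (pderiv_mfps i (p :: ('a::comm_ring_1, 'n::finite) mfps))"
  by (auto simp: order_ge_def mfps_coeff_pderiv)

lemma order_ge_power:
  "order_ge 1 (p :: ('a::comm_ring_1, 'n::finite) mfps) \<Longrightarrow> order_ge k (p ^ k)"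
  using order_ge_mult[of 1 p] by (induction k) auto

lemma order_ge_hom_part: "order_ge j (hom_part j p)"
  by (simp add: order_ge_def mfps_coeff_hom_part)

lemma hom_part_eq_0: "order_ge (Suc j) p \<Longrightarrow> hom_part j (p :: ('a::comm_ring_1, 'n::finite) mfps) = 0"
  by (auto intro!: mfps_eqI simp: order_ge_def mfps_coeff_hom_part)

lemma order_ge_all_imp_0: "(\<And>n. order_ge n p) \<Longrightarrow> p = (0 :: ('a::comm_ring_1, 'n::finite) mfps)"
  by (rule mfps_eqI) (auto simp: order_ge_def)

lemma order_ge_Suc_0: "order_ge (Suc 0) p \<longleftrightarrow> mfps_coeff p 0 = 0"
  by (auto simp: order_ge_def)

lemma order_ge_SucI: "order_ge n p \<Longrightarrow> hom_part n p = 0 \<Longrightarrow> order_ge (Suc n) (p :: ('a::comm_ring_1, 'n::finite) mfps)"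
  unfolding order_ge_def by (metis less_Suc_eq mfps_coeff_0 mfps_coeff_hom_part)

lemma hom_part_mult_linear:
  fixes p q :: "('a::comm_ring_1, 'n::finite) mfps"
  assumes q: "hom_part 1 q = q"
  shows "hom_part (Suc j) (p * q) = hom_part j p * q"
proof (rule mfps_eqI)
  fix m :: "nat ^ 'n"
  have q0: "mfps_coeff q b = 0" if "mdeg b \<noteq> 1" for b
    using q that by (metis mfps_coeff_hom_part)
  have "mfps_coeff (hom_part j p) a * mfps_coeff q b =
      (if mdeg m = Suc j then mfps_coeff p a * mfps_coeff q b else 0)" if "a + b = m" for a b
    using that q0[of b] by (auto simp: mfps_coeff_hom_part)
  then have "mfps_coeff (hom_part j p * q) m =
      (\<Sum>(a, b)\<in>splits m. if mdeg m = Suc j then mfps_coeff p a * mfps_coeff q b else 0)"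
    unfolding mfps_coeff_mult by (intro sum.cong) auto
  then show "mfps_coeff (hom_part (Suc j) (p * q)) m = mfps_coeff (hom_part j p * q) m"
    by (simp add: mfps_coeff_hom_part mfps_coeff_mult)
qed

section \<open>Linear parts and lowest-degree terms\<close>

lemma mfps_coeff_linear_vfield:
  "mfps_coeff (linear_vfield B $ i) m = (\<Sum>j\<in>UNIV. if m = axis j 1 then B $ i $ j else 0)"
  by (simp add: linear_vfield_cmat cmat_component mfps_coeff_var if_distrib[of "\<lambda>t. _ * t"] cong: if_cong)

lemma mfps_coeff_linear_vfield_axis: "mfps_coeff (linear_vfield B $ i) (axis j 1) = B $ i $ j"
  by (simp add: mfps_coeff_linear_vfield axis_eq_axis)

lemma hom_part_linear_vfield: "hom_part 1 (linear_vfield B $ i) = linear_vfield B $ i"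
  by (rule mfps_eqI) (auto simp: mfps_coeff_hom_part mfps_coeff_linear_vfield intro!: sum.neutral)

lemma order_ge_linear_vfield: "order_ge 1 (linear_vfield B $ i)"
  by (metis hom_part_linear_vfield order_ge_hom_part)

lemma linear_vfield_inject: "linear_vfield B = linear_vfield C \<longleftrightarrow> B = C"
  by (metis mfps_coeff_linear_vfield_axis vec_eq_iff)

lemma exponent_mdeg_1:
  assumes "mdeg m = 1"
  obtains j where "m = axis j 1"
proof -
  have "m \<noteq> 0" using assms by (metis mdeg_eq_0_iff zero_neq_one)
  then obtain a i where m: "m = a + axis i 1" by (rule exponent_nonzero_split_axis)
  with assms have "a = 0" by simp
  with m that show thesis by simp
qed

lemma hom_part_1_eq_linear_vfield: "hom_part 1 (g $ i) = linear_vfield (linear_part g) $ i"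
proof (rule mfps_eqI)
  fix m
  show "mfps_coeff (hom_part 1 (g $ i)) m = mfps_coeff (linear_vfield (linear_part g) $ i) m"
  proof (cases "mdeg m = 1")
    case True
    then obtain j where "m = axis j 1" by (rule exponent_mdeg_1)
    then show ?thesis
      by (simp add: mfps_coeff_hom_part mfps_coeff_linear_vfield axis_eq_axis linear_part_def)
  next
    case False
    then show ?thesis by (metis hom_part_linear_vfield mfps_coeff_hom_part)
  qed
qed

lemma order_ge_2_minus_linear_part:
  assumes "value_at_0 g = 0"
  shows "order_ge 2 ((g - linear_vfield (linear_part g)) $ i)"
proof -
  let ?p = "(g - linear_vfield (linear_part g)) $ i"
  have "mfps_coeff (g $ i) 0 = 0" using assms by (simp add: value_at_0_def vec_eq_iff)
  moreover have "mfps_coeff (linear_vfield (linear_part g) $ i) 0 = 0"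
    using order_ge_linear_vfield[of "linear_part g" i] by (simp add: order_ge_Suc_0)
  ultimately have "order_ge 1 ?p" by (simp add: order_ge_Suc_0)
  moreover have "hom_part 1 ?p = 0"
    by (simp only: vector_minus_component hom_part_diff hom_part_linear_vfield)
      (simp only: hom_part_1_eq_linear_vfield diff_self)
  ultimately show ?thesis using order_ge_SucI[of 1 ?p] by (simp add: numeral_2_eq_2)
qed

lemma order_ge_1_vfield: "value_at_0 g = 0 \<longleftrightarrow> (\<forall>i. order_ge 1 (g $ i))"
  by (simp add: value_at_0_def vec_eq_iff order_ge_Suc_0)

lemma order_ge_lie_deriv:
  assumes "\<And>i. order_ge (Suc d) (g $ i)" "order_ge a p"
  shows "order_ge (a + d) (lie_deriv g p)"
  unfolding lie_deriv_def
proof (rule order_ge_sum)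
  fix j
  \<comment> \<open>For a = 0 the truncated a - 1 is 0, and the bound is one better than
    required.\<close>
  have "order_ge (a - 1 + Suc d) (pderiv_mfps j p * g $ j)"
    by (intro order_ge_mult order_ge_pderiv assms)
  then show "order_ge (a + d) (pderiv_mfps j p * g $ j)" by (rule order_ge_mono) simp
qed

text \<open>Differentiation lowers the degree by one and a linear coefficient restores it. In degree
  0 both sides vanish.\<close>

lemma hom_part_lie_deriv_linear:
  "hom_part j (lie_deriv (linear_vfield B) p) = lie_deriv (linear_vfield B) (hom_part j p)"
proof (cases j)
  case 0
  have "order_ge 1 (lie_deriv (linear_vfield B) q)" for q
    using order_ge_lie_deriv[of 0 "linear_vfield B" 1 "q - mfps_const (mfps_coeff q 0)"] order_ge_linear_vfield[of B]
    by (simp add: order_ge_Suc_0 lie_deriv_diff mfps_coeff_const)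
  then have "hom_part 0 (lie_deriv (linear_vfield B) q) = 0" for q by (simp add: hom_part_eq_0)
  moreover have "hom_part 0 p = mfps_const (mfps_coeff p 0)"
    by (rule mfps_eqI) (auto simp: mfps_coeff_hom_part mfps_coeff_const)
  ultimately show ?thesis by (simp add: 0)
next
  case (Suc k)
  then show ?thesis
    by (simp add: lie_deriv_def hom_part_sum hom_part_mult_linear hom_part_linear_vfield hom_part_pderiv del: One_nat_def)
qed

lemma hom_part_cmat: "hom_part j (cmat B h $ i) = cmat B (\<chi> k. hom_part j (h $ k)) $ i"
  by (simp add: cmat_component hom_part_sum hom_part_const_mult)

lemma hom_part_lie_bracket_linear:
  "hom_part j (lie_bracket (linear_vfield B) h $ i) = lie_bracket (linear_vfield B) (\<chi> k. hom_part j (h $ k)) $ i"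
  by (simp add: lie_bracket_linear_component hom_part_diff hom_part_lie_deriv_linear hom_part_cmat)

text \<open>What remains of \<open>g\<close> after removing its linear part has order at least 2 and
  raises the order of \<open>p\<close>, so it does not reach degree \<open>j\<close>.\<close>

lemma hom_part_lie_deriv_lowest:
  assumes g: "value_at_0 g = 0" and p: "order_ge j p"
  shows "hom_part j (lie_deriv g p) = lie_deriv (linear_vfield (linear_part g)) (hom_part j p)"
proof -
  let ?L = "linear_vfield (linear_part g)"
  have "order_ge (j + 1) (lie_deriv (g - ?L) p)"
    using order_ge_2_minus_linear_part[OF g] p by (intro order_ge_lie_deriv) (simp_all add: numeral_2_eq_2)
  then have "hom_part j (lie_deriv (g - ?L) p) = 0" by (simp add: hom_part_eq_0)
  moreover have "lie_deriv g p = lie_deriv ?L p + lie_deriv (g - ?L) p"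
    by (simp add: lie_deriv_field_diff)
  ultimately show ?thesis by (simp add: hom_part_add hom_part_lie_deriv_linear)
qed

lemma hom_part_lie_bracket_lowest:
  assumes g: "value_at_0 g = 0" and h: "\<And>i. order_ge j (h $ i)"
  shows "hom_part j (lie_bracket g h $ i) =
    lie_bracket (linear_vfield (linear_part g)) (\<chi> k. hom_part j (h $ k)) $ i"
proof -
  let ?L = "linear_vfield (linear_part g)"
  have g2: "order_ge (Suc 1) ((g - ?L) $ i)" for i
    using order_ge_2_minus_linear_part[OF g] by (simp add: numeral_2_eq_2)
  have "order_ge (j + 1) (lie_deriv (g - ?L) (h $ i))"
    by (intro order_ge_lie_deriv g2 h)
  moreover have "order_ge (Suc j) (lie_deriv h ((g - ?L) $ i))"
    unfolding lie_deriv_def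
  proof (rule order_ge_sum)
    fix k
    have "order_ge (Suc 1 - 1 + j) (pderiv_mfps k ((g - ?L) $ i) * h $ k)"
      by (intro order_ge_mult order_ge_pderiv g2 h)
    then show "order_ge (Suc j) (pderiv_mfps k ((g - ?L) $ i) * h $ k)" by simp
  qed
  ultimately have "order_ge (Suc j) (lie_bracket (g - ?L) h $ i)"
    unfolding lie_bracket_component by (intro order_ge_diff) simp_all
  then have "hom_part j (lie_bracket (g - ?L) h $ i) = 0" by (rule hom_part_eq_0)
  moreover have "lie_bracket g h = lie_bracket ?L h + lie_bracket (g - ?L) h"
    by (simp add: lie_bracket_diff_left)
  ultimately show ?thesis by (simp add: hom_part_add hom_part_lie_bracket_linear)
qed

text \<open>This is the infinite sum only when \<open>a k\<close> has order at least \<open>k\<close>, so that the terms left out of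
  each coefficient vanish.\<close>

definition mfps_suminf :: "(nat \<Rightarrow> ('a::comm_ring_1, 'n::finite) mfps) \<Rightarrow> ('a, 'n) mfps" where
  "mfps_suminf a = Mfps (\<lambda>m. \<Sum>k\<le>mdeg m. mfps_coeff (a k) m)"

lemma order_ge_mfps_suminf_minus_partial:
  assumes "\<And>k. order_ge k (a k)"
  shows "order_ge (Suc n) (mfps_suminf a - (\<Sum>k\<le>n. a k))"
  unfolding order_ge_def
proof (intro allI impI)
  fix m :: "nat ^ 'b" assume "mdeg m < Suc n"
  then have "(\<Sum>k\<le>mdeg m. mfps_coeff (a k) m) = (\<Sum>k\<le>n. mfps_coeff (a k) m)"
    by (intro sum.mono_neutral_left) (use assms in \<open>auto simp: order_ge_def\<close>)
  then show "mfps_coeff (mfps_suminf a - (\<Sum>k\<le>n. a k)) m = 0"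
    by (simp add: mfps_suminf_def)
qed

section \<open>Invertible series and the exponential\<close>

lemma one_minus_dvd_1:
  fixes p :: "('a::comm_ring_1, 'n::finite) mfps"
  assumes "mfps_coeff p 0 = 0"
  shows "(1 - p) dvd 1"
proof -
  have p: "order_ge 1 p" using assms by (simp add: order_ge_Suc_0)
  \<comment> \<open>The inverse is the geometric series; comparison with its partial sums shows that
    the error has every order.\<close>
  let ?q = "mfps_suminf ((^) p)"
  have "order_ge n ((1 - p) * ?q - 1)" for n
  proof -
    have "(1 - p) * ?q - 1 = (1 - p) * (?q - (\<Sum>k\<le>n. p ^ k)) - p ^ Suc n"
      using one_diff_power_eq[of p "Suc n"] by (simp add: lessThan_Suc_atMost algebra_simps)
    moreover have "order_ge (Suc n) (p ^ Suc n)" using p by (rule order_ge_power)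
    moreover have "order_ge (0 + Suc n) ((1 - p) * (?q - (\<Sum>k\<le>n. p ^ k)))"
      by (intro order_ge_mult order_ge_mfps_suminf_minus_partial order_ge_power p order_ge_0)
    ultimately have "order_ge (Suc n) ((1 - p) * ?q - 1)" by (simp add: order_ge_diff)
    then show ?thesis by (rule order_ge_mono) simp
  qed
  then have "(1 - p) * ?q - 1 = 0" by (rule order_ge_all_imp_0)
  then show ?thesis by (metis dvd_triv_left eq_iff_diff_eq_0)
qed

text \<open>This is the exponential of \<open>p\<close> when \<open>p\<close> has no constant term,
  since then \<open>p ^ k\<close> has order at least \<open>k\<close>.\<close>

definition mfps_exp :: "'n::finite series \<Rightarrow> 'n series" where
  "mfps_exp p = mfps_suminf (\<lambda>k. mfps_const (1 / fact k) * p ^ k)"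

lemma mfps_coeff_exp_0: "mfps_coeff (mfps_exp p) 0 = 1"
proof -
  have "mdeg (0 :: nat ^ 'a) = 0" by simp
  then show ?thesis
    by (simp add: mfps_exp_def mfps_suminf_def mfps_coeff_1 del: mdeg_eq_0_iff)
qed

lemma mfps_exp_dvd_1: "mfps_exp p dvd 1"
  using one_minus_dvd_1[of "1 - mfps_exp p"] by (simp add: mfps_coeff_exp_0 mfps_coeff_1)

lemma lie_deriv_power: "lie_deriv g (p ^ Suc k) = mfps_const (of_nat (Suc k)) * (lie_deriv g p * p ^ k)"
proof (induction k)
  case (Suc k)
  have c: "mfps_const (of_nat (Suc (Suc k)) :: complex) = mfps_const (of_nat (Suc k)) + (1 :: 'a series)"
    by (simp only: of_nat_Suc[of "Suc k"] mfps_const_add mfps_const_1 add.commute)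
  have "lie_deriv g (p ^ Suc (Suc k)) = lie_deriv g p * p ^ Suc k + p * lie_deriv g (p ^ Suc k)"
    by (subst power_Suc) (rule lie_deriv_mult)
  also have "\<dots> = mfps_const (of_nat (Suc (Suc k))) * (lie_deriv g p * p ^ Suc k)"
    unfolding Suc c by (simp add: algebra_simps del: of_nat_Suc)
  finally show ?case .
qed simp

text \<open>The derivation sends partial sum n + 1 to \<open>lie_deriv g p\<close> times partial sum
  n. As g(0) = 0, it does not lower orders, so the two sides differ by a series of every
  order.\<close>

lemma lie_deriv_exp:
  assumes g: "value_at_0 g = 0" and p: "mfps_coeff p 0 = 0"
  shows "lie_deriv g (mfps_exp p) = lie_deriv g p * mfps_exp p"
proof -
  define e where "e n = (\<Sum>k\<le>n. mfps_const (1 / fact k) * p ^ k)" for n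
  have "order_ge 1 p" using p by (simp add: order_ge_Suc_0)
  then have "order_ge k (mfps_const (1 / fact k) * p ^ k)" for k
    using order_ge_mult[OF order_ge_0 order_ge_power] by fastforce
  then have approx: "order_ge (Suc n) (mfps_exp p - e n)" for n
    unfolding mfps_exp_def e_def by (rule order_ge_mfps_suminf_minus_partial)
  have e: "lie_deriv g (e (Suc n)) = lie_deriv g p * e n" for n
  proof -
    have step: "lie_deriv g (mfps_const (1 / fact (Suc k)) * p ^ Suc k) =
      lie_deriv g p * (mfps_const (1 / fact k) * p ^ k)" for k
    proof -
      have "(1 :: complex) / fact k = 1 / fact (Suc k) * of_nat (Suc k)"
        by (simp add: field_simps del: of_nat_Suc)
      then have c: "mfps_const (1 / fact k) = mfps_const (1 / fact (Suc k)) * mfps_const (of_nat (Suc k) :: complex)"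
        by (simp only: mfps_const_mult)
      have "lie_deriv g (mfps_const (1 / fact (Suc k)) * p ^ Suc k) =
        mfps_const (1 / fact (Suc k)) * (mfps_const (of_nat (Suc k)) * (lie_deriv g p * p ^ k))"
        by (simp only: lie_deriv_const_mult lie_deriv_power)
      then show ?thesis by (simp only: c mult_ac)
    qed
    have "lie_deriv g (e (Suc n)) = (\<Sum>k\<le>Suc n. lie_deriv g (mfps_const (1 / fact k) * p ^ k))"
      by (simp only: e_def lie_deriv_sum)
    also have "\<dots> = lie_deriv g (mfps_const (1 / fact 0) * p ^ 0) +
        (\<Sum>k\<le>n. lie_deriv g (mfps_const (1 / fact (Suc k)) * p ^ Suc k))"
      by (rule sum.atMost_Suc_shift)
    also have "\<dots> = lie_deriv g p * e n"
      unfolding step by (simp add: e_def sum_distrib_left)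
    finally show ?thesis .
  qed
  have "order_ge n (lie_deriv g (mfps_exp p) - lie_deriv g p * mfps_exp p)" for n
  proof -
    have "lie_deriv g (mfps_exp p) - lie_deriv g p * mfps_exp p =
      lie_deriv g (mfps_exp p - e (Suc n)) - lie_deriv g p * (mfps_exp p - e n)"
      by (simp add: lie_deriv_diff e algebra_simps)
    moreover have "order_ge n (lie_deriv g (mfps_exp p - e (Suc n)))"
      using order_ge_lie_deriv[of 0 g, OF _ approx[of "Suc n"]] g
      by (auto simp: order_ge_1_vfield intro: order_ge_mono)
    moreover have "order_ge n (lie_deriv g p * (mfps_exp p - e n))"
      using order_ge_mult[OF order_ge_0 approx[of n]] by (rule order_ge_mono) simp
    ultimately show ?thesis by (simp add: order_ge_diff)
  qed
  then have "lie_deriv g (mfps_exp p) - lie_deriv g p * mfps_exp p = 0" by (rule order_ge_all_imp_0)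
  then show ?thesis by simp
qed

subsection \<open>Normalizers of vector fields in normal form\<close>

lemma lie_deriv_field_0 [simp]: "lie_deriv 0 p = 0"
  by (simp add: lie_deriv_def)

lemma lie_bracket_0_left [simp]: "lie_bracket 0 h = 0"
  using lie_bracket_commute[of 0 h] by simp

lemma lie_deriv_commute:
  "lie_bracket g h = 0 \<Longrightarrow> lie_deriv g (lie_deriv h p) = lie_deriv h (lie_deriv g p)"
  using lie_deriv_lie_bracket[of g h p] by simp

lemma lie_bracket_bracket_commute:
  "lie_bracket g h = 0 \<Longrightarrow> lie_bracket g (lie_bracket h k) = lie_bracket h (lie_bracket g k)"
  using lie_bracket_jacobi[of g h k] by simp

lemma lie_bracket_linear_eq_0_iff:
  "lie_bracket (linear_vfield B) (linear_vfield C) = 0 \<longleftrightarrow> B ** C = C ** B"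
  by (auto simp: lie_bracket_linear_linear linear_vfield_inject)

text \<open>The equation is solved degree by degree with \<open>annihilated_split_sum\<close>. The
  matrix \<open>S\<close> is a symmetry that the solution must keep: it is 0 when \<beta> is
  constructed, and the semisimple part of the linear part of f when \<sigma> is constructed.\<close>

lemma homological_split:
  fixes g :: "'n::finite vfield"
  assumes g0: "value_at_0 g = 0" and lin: "linear_part g = L + N"
    and L: "semisimple_matrix L" and N: "nilpotent_matrix N" and LN: "L ** N = N ** L"
    and SL: "lie_bracket (linear_vfield S) (linear_vfield L) = 0"
    and SN: "lie_bracket (linear_vfield S) (linear_vfield N) = 0"
    and Sg: "lie_bracket (linear_vfield S) g = 0"
    and p: "lie_deriv (linear_vfield S) p = 0"
  obtains u w where "lie_deriv (linear_vfield S) u = 0" "lie_deriv (linear_vfield S) w = 0"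
    "lie_deriv (linear_vfield L) u = 0" "p = u + lie_deriv g w" "mfps_coeff w 0 = 0"
proof -
  let ?S = "lie_deriv (linear_vfield S)" and ?L = "lie_deriv (linear_vfield L)"
    and ?N = "lie_deriv (linear_vfield N)"
  \<comment> \<open>The homogeneous first integrals of \<open>S\<close> of degree \<open>j\<close>;
    they are preserved by \<open>?L\<close> and \<open>?N\<close> because both fields commute with
    \<open>S\<close>.\<close>
  define K where "K j = {t. ?S t = 0 \<and> hom_part j t = t}" for j
  have solvable: "\<exists>w\<in>K j. ?L (t - (?L w + ?N w)) = 0" if t: "t \<in> K j" for j t
  proof -
    have fin: "finite {m. mfps_coeff v m \<noteq> 0}" if "v \<in> K j" for v
      using finite_support_hom_part[of j v] that by (simp add: K_def)
    obtain k where k: "(?N ^^ k) t = 0" using nilpotent_lie_deriv[OF N fin[OF t]] by auto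
    have "\<exists>u\<in>K j. \<exists>w\<in>K j. t = u + (?L w + ?N w) \<and> ?L u = 0"
    proof (rule ser.annihilated_split_sum[OF lie_deriv_module_hom lie_deriv_module_hom])
      show "?L (?N v) = ?N (?L v)" for v
        using LN by (intro lie_deriv_commute) (simp add: lie_bracket_linear_eq_0_iff)
      show "ser.subspace (K j)"
        by (rule ser.subspaceI)
          (auto simp: K_def lie_deriv_add lie_deriv_const_mult hom_part_add hom_part_const_mult)
      show "?L v \<in> K j" "?N v \<in> K j" if "v \<in> K j" for v
        using that lie_deriv_commute[OF SL, of v] lie_deriv_commute[OF SN, of v]
        by (simp_all add: K_def hom_part_lie_deriv_linear)
      show "ser.annihilated ?L v" if "v \<in> K j" for v
        using ser.eigenspan_annihilated[OF lie_deriv_module_hom semisimple_lie_deriv_eigenspan[OF L fin[OF that]]] .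
    qed (fact t k)+
    then obtain u w where "w \<in> K j" "t = u + (?L w + ?N w)" "?L u = 0" by auto
    then show ?thesis by (intro bexI[of _ w]) simp_all
  qed
  define pick where "pick j t = (SOME w. w \<in> K j \<and> ?L (t - (?L w + ?N w)) = 0)" for j t
  have "pick j t \<in> K j \<and> ?L (t - (?L (pick j t) + ?N (pick j t))) = 0" if "t \<in> K j" for j t
    unfolding pick_def by (rule someI_ex) (use solvable[OF that] in blast)
  then have pick: "pick j t \<in> K j" "?L (t - (?L (pick j t) + ?N (pick j t))) = 0"
    if "t \<in> K j" for j t using that by blast+
  \<comment> \<open>Here \<open>s j\<close> collects the corrections in degrees below
    \<open>j\<close>, and the next correction treats the degree-\<open>j\<close> part of the defect
    left by \<open>s j\<close>.\<close>
  define s where "s = rec_nat 0 (\<lambda>j s. s + pick j (hom_part j (p - lie_deriv g s)))"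
  define a where "a j = pick j (hom_part j (p - lie_deriv g (s j)))" for j
  have s_Suc: "s (Suc j) = s j + a j" and s_0: "s 0 = 0" for j by (simp_all add: s_def a_def)
  have tK: "hom_part j (p - lie_deriv g v) \<in> K j" if "?S v = 0" for j v
    using p that lie_deriv_commute[OF Sg, of v]
    by (simp add: K_def lie_deriv_diff flip: hom_part_lie_deriv_linear)
  have sS: "?S (s j) = 0" for j
  proof (induction j)
    case (Suc j)
    then have "a j \<in> K j" unfolding a_def by (intro pick tK)
    with Suc show ?case by (simp add: s_Suc lie_deriv_add K_def)
  qed (simp add: s_0)
  have aK: "a j \<in> K j" for j unfolding a_def by (intro pick tK sS)
  have ord_a: "order_ge j (a j)" for j
    using order_ge_hom_part[of j "a j"] aK[of j] by (simp add: K_def)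
  have s_sum: "s (Suc n) = (\<Sum>k\<le>n. a k)" for n
    by (induction n) (simp_all add: s_Suc s_0)
  define w where "w = mfps_suminf a"
  have approx: "order_ge (Suc n) (w - s (Suc n))" for n
    unfolding w_def s_sum by (rule order_ge_mfps_suminf_minus_partial[OF ord_a])
  have g1: "order_ge (Suc 0) (g $ i)" for i using g0 by (simp add: order_ge_1_vfield)
  have Sw: "?S w = 0"
  proof (rule hom_part_ext)
    fix j
    have "hom_part j w = hom_part j (s (Suc j))"
      using hom_part_eq_0[OF approx[of j]] by (simp add: hom_part_diff)
    then have "hom_part j (?S w) = hom_part j (?S (s (Suc j)))"
      by (simp add: hom_part_lie_deriv_linear)
    then show "hom_part j (?S w) = hom_part j 0" by (simp add: sS)
  qed
  have Lu: "?L (p - lie_deriv g w) = 0"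
  proof (rule hom_part_ext)
    fix j
    have "order_ge (Suc j + 0) (lie_deriv g (w - s (Suc j)))"
      by (intro order_ge_lie_deriv g1 approx)
    then have "hom_part j (lie_deriv g w) = hom_part j (lie_deriv g (s (Suc j)))"
      using hom_part_eq_0[of j "lie_deriv g (w - s (Suc j))"] by (simp add: lie_deriv_diff hom_part_diff)
    \<comment> \<open>The correction \<open>a j\<close> has order at least \<open>j\<close>, so in
      degree \<open>j\<close> only the linear part L + N of \<open>g\<close> acts on it.\<close>
    also have "\<dots> = hom_part j (lie_deriv g (s j)) + (?L (a j) + ?N (a j))"
      using hom_part_lie_deriv_lowest[OF g0 ord_a] aK[of j]
      by (simp add: s_Suc lie_deriv_add hom_part_add lin linear_vfield_add lie_deriv_field_add K_def)
    finally have "hom_part j (p - lie_deriv g w) = hom_part j (p - lie_deriv g (s j)) - (?L (a j) + ?N (a j))"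
      by (simp add: hom_part_diff)
    then have "?L (hom_part j (p - lie_deriv g w)) = 0"
      using pick(2)[OF tK[OF sS], of j j] unfolding a_def[symmetric] by simp
    then show "hom_part j (?L (p - lie_deriv g w)) = hom_part j 0"
      by (simp add: hom_part_lie_deriv_linear)
  qed
  have "?S (p - lie_deriv g w) = 0"
    using lie_deriv_commute[OF Sg, of w] by (simp add: lie_deriv_diff p Sw)
  \<comment> \<open>Removing the constant term of \<open>w\<close> changes no derivative and makes
    \<open>- w\<close> admissible for the exponential.\<close>
  then show thesis
    using that[of "p - lie_deriv g w" "w - mfps_const (mfps_coeff w 0)"] Lu Sw
    by (simp add: lie_deriv_diff mfps_coeff_const)
qed

text \<open>Finite support makes \<open>h\<close> a sum of eigenvectors for \<open>L\<close> and the
  bracket with \<open>N\<close> nilpotent at \<open>h\<close>, as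
  \<open>annihilated_kernel_sum\<close> demands.\<close>

lemma lie_bracket_kernel_semisimple_part:
  fixes L N :: "complex ^ 'n::finite ^ 'n"
  assumes L: "semisimple_matrix L" and N: "nilpotent_matrix N" and LN: "L ** N = N ** L"
    and h: "\<And>i. finite {m. mfps_coeff (h $ i) m \<noteq> 0}"
    and eq: "lie_bracket (linear_vfield (L + N)) h = 0"
  shows "lie_bracket (linear_vfield L) h = 0"
proof -
  obtain k where k: "(lie_bracket (linear_vfield N) ^^ k) h = 0"
    using nilpotent_lie_bracket[OF N h] by auto
  show ?thesis
  proof (rule vf.annihilated_kernel_sum[OF lie_bracket_module_hom lie_bracket_module_hom _ _ k])
    show "lie_bracket (linear_vfield L) (lie_bracket (linear_vfield N) v) =
      lie_bracket (linear_vfield N) (lie_bracket (linear_vfield L) v)" for v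
      using LN by (intro lie_bracket_bracket_commute) (simp add: lie_bracket_linear_eq_0_iff)
    show "vf.annihilated (lie_bracket (linear_vfield L)) h"
      by (intro vf.eigenspan_annihilated lie_bracket_module_hom semisimple_lie_bracket_eigenspan L h)
    show "lie_bracket (linear_vfield L) h + lie_bracket (linear_vfield N) h = 0"
      using eq by (simp add: linear_vfield_add lie_bracket_add_left)
  qed
qed

lemma finite_support_linear_vfield: "finite {m. mfps_coeff (linear_vfield B $ i) m \<noteq> 0}"
  by (metis finite_support_hom_part hom_part_linear_vfield)

text \<open>Commuting with C puts the linear field of \<open>S\<close> into the kernel of the
  bracket with L + N, hence into that of the bracket with \<open>L\<close>; the claim for
  \<open>N\<close> follows by subtraction.\<close>

lemma jordan_chevalley_commutes:
  assumes "jordan_chevalley C L N" "C ** S = S ** C"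
  shows "L ** S = S ** L" "N ** S = S ** N"
proof -
  have C: "C = L + N" and L: "semisimple_matrix L" "nilpotent_matrix N" "L ** N = N ** L"
    using assms(1) by (auto simp: jordan_chevalley_def)
  show LS: "L ** S = S ** L"
    using lie_bracket_kernel_semisimple_part[OF L finite_support_linear_vfield, of S] assms(2)
    unfolding C lie_bracket_linear_eq_0_iff by blast
  show "N ** S = S ** N"
    using LS assms(2) 
    by (simp add: C vec_eq_iff matrix_matrix_mult_def distrib_left distrib_right sum.distrib)
qed

text \<open>The Jacobi identity gives [y, f] = 0 for y = [S, h]. If y has order at least n, its
  degree-n part is killed by the bracket with S + N, hence by that with S. Being itself [S, h_n], it
  vanishes by \<open>annihilated_square_zero\<close>.\<close>

lemma normalizing_field_commutes_semisimple_part: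
  assumes f0: "value_at_0 f = 0" and jc: "jordan_chevalley (linear_part f) S N"
    and Sf: "lie_bracket (linear_vfield S) f = 0"
    and hf: "lie_bracket h f = \<alpha> *s f" and S\<alpha>: "lie_deriv (linear_vfield S) \<alpha> = 0"
  shows "lie_bracket (linear_vfield S) h = 0"
proof -
  have A: "linear_part f = S + N" and S: "semisimple_matrix S" and N: "nilpotent_matrix N"
    and SN: "S ** N = N ** S" using jc by (auto simp: jordan_chevalley_def)
  define y where "y = lie_bracket (linear_vfield S) h"
  have "lie_bracket y f = 0"
    unfolding y_def lie_bracket_jacobi hf Sf
    by (simp add: lie_bracket_scale_right Sf S\<alpha>)
  then have fy: "lie_bracket f y = 0" using lie_bracket_commute[of f y] by simp
  have "\<forall>i. order_ge n (y $ i)" for n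
  proof (induction n)
    case (Suc n)
    define yn hn where "yn = (\<chi> k. hom_part n (y $ k))" and "hn = (\<chi> k. hom_part n (h $ k))"
    have yn: "yn = lie_bracket (linear_vfield S) hn"
      by (simp add: vec_eq_iff yn_def hn_def y_def hom_part_lie_bracket_linear)
    have "lie_bracket (linear_vfield (S + N)) yn $ i = 0" for i
      using hom_part_lie_bracket_lowest[OF f0, of n y i] Suc fy by (simp add: yn_def A)
    then have "lie_bracket (linear_vfield (S + N)) yn = 0" by (simp add: vec_eq_iff)
    then have "lie_bracket (linear_vfield S) yn = 0"
      by (rule lie_bracket_kernel_semisimple_part[OF S N SN, rotated])
        (simp add: yn_def finite_support_hom_part)
    moreover have "vf.annihilated (lie_bracket (linear_vfield S)) hn"
      by (intro vf.eigenspan_annihilated lie_bracket_module_hom semisimple_lie_bracket_eigenspan S)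
        (simp add: hn_def finite_support_hom_part)
    ultimately have "yn = 0"
      using vf.annihilated_square_zero[OF lie_bracket_module_hom] yn by metis
    then show ?case using Suc by (auto simp: yn_def vec_eq_iff intro: order_ge_SucI)
  qed simp
  then have "y = 0" by (simp add: vec_eq_iff order_ge_all_imp_0)
  then show ?thesis by (simp add: y_def)
qed

section \<open>The constant term of the normalizing factor\<close>

lemma hom_part_1_mult:
  fixes p q :: "('a::comm_ring_1, 'n::finite) mfps"
  assumes "order_ge 1 q"
  shows "hom_part 1 (p * q) = mfps_const (mfps_coeff p 0) * hom_part 1 q"
proof -
  let ?c = "mfps_const (mfps_coeff p 0) :: ('a, 'n) mfps"
  have "order_ge (1 + 1) ((p - ?c) * q)"
    using assms by (intro order_ge_mult) (simp_all add: order_ge_Suc_0 mfps_coeff_const)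
  then have "hom_part 1 ((p - ?c) * q) = 0" by (intro hom_part_eq_0) simp
  moreover have "p * q = ?c * q + (p - ?c) * q" by (simp add: algebra_simps)
  ultimately show ?thesis by (simp only: hom_part_add hom_part_const_mult add_0_right)
qed

lemma lie_bracket_linear_parts:
  assumes "value_at_0 g = 0" "value_at_0 h = 0"
  shows "hom_part 1 (lie_bracket g h $ i) =
    (linear_vfield (linear_part h ** linear_part g) - linear_vfield (linear_part g ** linear_part h)) $ i"
proof -
  have "(\<chi> k. hom_part 1 (h $ k)) = linear_vfield (linear_part h)"
    by (simp add: vec_eq_iff hom_part_1_eq_linear_vfield del: One_nat_def)
  then show ?thesis
    using hom_part_lie_bracket_lowest[OF assms(1), of 1 h i] assms(2)
    unfolding order_ge_1_vfield by (simp only: lie_bracket_linear_linear)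
qed

lemma value_at_0_linear_vfield: "value_at_0 (linear_vfield B) = 0"
  by (simp add: order_ge_1_vfield order_ge_linear_vfield del: One_nat_def)

lemma linear_part_linear_vfield: "linear_part (linear_vfield B) = B"
  by (simp add: vec_eq_iff linear_part_def mfps_coeff_linear_vfield_axis del: One_nat_def)

lemma linear_part_commutes:
  assumes "value_at_0 h = 0" "lie_bracket (linear_vfield S) h = 0"
  shows "linear_part h ** S = S ** linear_part h"
proof -
  have "(linear_vfield (linear_part h ** S) - linear_vfield (S ** linear_part h)) $ i = 0" for i
    using lie_bracket_linear_parts[OF value_at_0_linear_vfield assms(1), of S i] assms(2)
    by (simp add: linear_part_linear_vfield)
  then have "linear_vfield (linear_part h ** S) = linear_vfield (S ** linear_part h)"
    by (simp add: vec_eq_iff)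
  then show ?thesis by (simp only: linear_vfield_inject)
qed

text \<open>The degree-1 part of [h, f] = \<alpha> f reads A C - C A = \<alpha>_0 A. Since C
  commutes with \<open>S\<close>, only the commutator with \<open>N\<close> survives on the left,
  which is the situation of \<open>semisimple_zero_of_scaled_commutator\<close>.\<close>

lemma normalizing_factor_vanishes_at_0:
  assumes f0: "value_at_0 f = 0" and h0: "value_at_0 h = 0"
    and jc: "jordan_chevalley (linear_part f) S N" and "S \<noteq> 0"
    and hf: "lie_bracket h f = \<alpha> *s f" and Sh: "lie_bracket (linear_vfield S) h = 0"
  shows "mfps_coeff \<alpha> 0 = 0"
proof (rule ccontr)
  assume \<alpha>0: "mfps_coeff \<alpha> 0 \<noteq> 0"
  let ?C = "linear_part h" and ?A = "linear_part f" and ?c = "mfps_coeff \<alpha> 0"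
  have A: "?A = S + N" and S: "semisimple_matrix S" and N: "nilpotent_matrix N"
    and SN: "S ** N = N ** S" using jc by (auto simp: jordan_chevalley_def)
  have CS: "?C ** S = S ** ?C" by (rule linear_part_commutes[OF h0 Sh])
  have "(linear_vfield (?A ** ?C) - linear_vfield (?C ** ?A)) $ i = mfps_const ?c * linear_vfield ?A $ i" for i
  proof -
    have "hom_part 1 ((\<alpha> *s f) $ i) = mfps_const ?c * linear_vfield ?A $ i"
      using f0 hom_part_1_mult[of "f $ i" \<alpha>] unfolding order_ge_1_vfield
      by (simp add: hom_part_1_eq_linear_vfield del: One_nat_def)
    then show ?thesis using lie_bracket_linear_parts[OF h0 f0, of i] hf by simp
  qed
  then have "mfps_coeff ((linear_vfield (?A ** ?C) - linear_vfield (?C ** ?A)) $ i) (axis j 1) =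
    mfps_coeff (mfps_const ?c * linear_vfield ?A $ i) (axis j 1)" for i j by simp
  then have comp: "(?A ** ?C - ?C ** ?A) $ i $ j = ?c * ?A $ i $ j" for i j
    by (simp add: mfps_coeff_linear_vfield_axis del: One_nat_def)
  have vec: "?A *v (?C *v v) - ?C *v (?A *v v) = ?c *s (?A *v v)" for v
  proof -
    have "(?A ** ?C - ?C ** ?A) *v v = ?c *s (?A *v v)"
      by (simp add: vec_eq_iff matrix_vector_mult_def sum_distrib_left comp mult.assoc del: vector_minus_component)
    then show ?thesis by (simp add: matrix_vector_mult_diff_rdistrib matrix_vector_mul_assoc)
  qed
  have "N *v (?C *v v) - ?C *v (N *v v) = ?c *s (S *v v + N *v v)" for v
  proof -
    have "S *v (?C *v v) = ?C *v (S *v v)" by (simp add: matrix_vector_mul_assoc CS)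
    then show ?thesis
      using vec[of v] unfolding A by (simp add: matrix_vector_mult_add_rdistrib matrix_vector_right_distrib)
  qed
  then have "S = 0"
    by (rule semisimple_zero_of_scaled_commutator[OF S N SN CS[symmetric]]) (fact \<alpha>0)
  with \<open>S \<noteq> 0\<close> show False by contradiction
qed

section \<open>Adjusting elements of the normalizer by multiples of f\<close>

lemma lie_bracket_adjust:
  assumes "lie_bracket g f = l *s f"
  shows "lie_bracket (g - \<beta> *s f) f = (l + lie_deriv f \<beta>) *s f"
  using assms by (simp add: lie_bracket_diff_left lie_bracket_scale_left lie_bracket_self vec_eq_iff algebra_simps)

lemma normalizer_adjust:
  assumes f0: "value_at_0 f = 0" and jc: "jordan_chevalley (linear_part f) S N"
    and Sf: "lie_bracket (linear_vfield S) f = 0" and g: "g \<in> normalizer f"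
  obtains \<beta> \<alpha> where "lie_bracket (g - \<beta> *s f) f = \<alpha> *s f" "lie_deriv (linear_vfield S) \<alpha> = 0"
proof -
  have A: "linear_part f = S + N" and S: "semisimple_matrix S" and N: "nilpotent_matrix N"
    and SN: "S ** N = N ** S" using jc by (auto simp: jordan_chevalley_def)
  obtain l where l: "lie_bracket g f = l *s f" using g by (auto simp: normalizer_def)
  \<comment> \<open>With symmetry matrix 0 the side conditions hold trivially, and the semisimple
    part of the linear part of \<open>f\<close> takes the place of L.\<close>
  obtain u w where uw: "lie_deriv (linear_vfield S) u = 0" "l = u + lie_deriv f w"
    by (rule homological_split[OF f0 A S N SN, of 0 l]) auto
  have "lie_bracket (g - (- w) *s f) f = u *s f"
    unfolding lie_bracket_adjust[OF l] by (simp add: uw(2) lie_deriv_uminus)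
  then show thesis using uw(1) by (rule that)
qed

text \<open>The normalizer equality concerns fields that are not assumed to vanish at 0. The
  constant term of [g, f] = l f gives A g(0) = 0, hence S g(0) = 0. A nonzero coordinate (Q g(0))_i
  would force d_i = 0, and then the linear form (Q x)_i would be a nonconstant first
  integral.\<close>

lemma normalizer_value_at_0:
  fixes f g :: "'n::finite vfield"
  assumes f0: "value_at_0 f = 0" and jc: "jordan_chevalley (linear_part f) S N"
    and const: "\<And>\<phi>. first_integral (linear_vfield S) \<phi> \<Longrightarrow> \<exists>c. \<phi> = mfps_const c"
    and g: "g \<in> normalizer f"
  shows "value_at_0 g = 0"
proof -
  have A: "linear_part f = S + N" and S: "semisimple_matrix S" and N: "nilpotent_matrix N"
    and SN: "S ** N = N ** S" using jc by (auto simp: jordan_chevalley_def)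
  let ?v = "value_at_0 g"
  obtain l where l: "lie_bracket g f = l *s f" using g by (auto simp: normalizer_def)
  have f0': "mfps_coeff (f $ i) 0 = 0" for i using f0 by (simp add: value_at_0_def vec_eq_iff)
  have "((S + N) *v ?v) $ i = mfps_coeff (lie_bracket g f $ i) 0" for i
    by (simp add: A[symmetric] lie_bracket_component lie_deriv_def mfps_coeff_mult_0 f0'
        mfps_coeff_pderiv matrix_vector_mult_def linear_part_def value_at_0_def)
  also have "mfps_coeff (lie_bracket g f $ i) 0 = 0" for i by (simp add: l mfps_coeff_mult_0 f0')
  finally have "(S + N) *v ?v = 0" by (simp add: vec_eq_iff)
  then have Sv: "S *v ?v = 0" by (rule semisimple_nilpotent_sum_kernel[OF S N SN])
  obtain P Q :: "complex ^ 'n ^ 'n" and d where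
    PQ: "P ** Q = mat 1" "Q ** P = mat 1" and d: "S = P ** diag_matrix d ** Q"
    using semisimple_diagonalizable[OF S] .
  have QS: "Q ** S = diag_matrix d ** Q"
    by (simp add: d matrix_mul_assoc PQ matrix_mul_lid)
  have "(Q *v ?v) $ i = 0" for i
  proof (rule ccontr)
    assume ne: "(Q *v ?v) $ i \<noteq> 0"
    have "diag_matrix d *v (Q *v ?v) = Q *v (S *v ?v)"
      by (simp add: matrix_vector_mul_assoc QS)
    then have "d $ i * (Q *v ?v) $ i = 0" by (simp add: Sv diag_matrix_mult_vec vec_eq_iff)
    with ne have "d $ i = 0" by simp
    then have "lie_deriv (linear_vfield S) (linear_vfield Q $ i) = 0"
      by (simp add: lie_deriv_linear_vfield linear_vfield_cmat[of S] cmat_cmat QS)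
        (simp add: cmat_diag_matrix_component flip: cmat_cmat)
    then obtain c where "linear_vfield Q $ i = mfps_const c"
      using const[of "linear_vfield Q $ i"] by (auto simp: first_integral_def)
    \<comment> \<open>A constant has no linear coefficients, so the whole i-th row of
      \<open>Q\<close> would vanish.\<close>
    then have "Q $ i $ j = 0" for j
      using mfps_coeff_linear_vfield_axis[of Q i j] mdeg_axis[of j 1]
      by (auto simp: mfps_coeff_const simp del: mdeg_axis split: if_splits)
    with ne show False by (simp add: matrix_vector_mult_def)
  qed
  then have "Q *v ?v = 0" by (simp add: vec_eq_iff)
  then have "P *v (Q *v ?v) = 0" by simp
  then show ?thesis by (simp add: matrix_vector_mul_assoc PQ)
qed

theorem theorem1:
  fixes f g :: "'n::finite vfield" and A As An :: "complex ^ 'n ^ 'n"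
  assumes "value_at_0 f = 0" and "linear_part f = A"
    and "jordan_chevalley A As An"
    and "poincare_dulac_nf f"
    and "As \<noteq> 0"
    and "g \<in> normalizer f" and "value_at_0 g = 0"
  shows
    "(\<exists>\<beta> \<alpha>. lie_bracket (g - \<beta> *s f) f = \<alpha> *s f \<and>
        lie_deriv (linear_vfield As) \<alpha> = 0 \<and> mfps_coeff \<alpha> 0 = 0)
     \<and> ((\<forall>\<phi>. first_integral (linear_vfield As) \<phi> \<longrightarrow> (\<exists>c. \<phi> = mfps_const c)) \<longrightarrow>
        normalizer f = {h + \<beta> *s f | h \<beta>. h \<in> centralizer f})
     \<and> (\<forall>\<beta> \<alpha> h. lie_bracket (g - \<beta> *s f) f = \<alpha> *s f \<and>
          lie_deriv (linear_vfield As) \<alpha> = 0 \<and> h = g - \<beta> *s f \<longrightarrow>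
          mfps_coeff \<alpha> 0 = 0
          \<and> lie_bracket (linear_vfield As) h = 0
          \<and> (\<forall>C Cs Cn. linear_part h = C \<and> jordan_chevalley C Cs Cn \<longrightarrow>
              (\<exists>\<sigma> \<alpha>'. \<sigma> dvd 1 \<and> mfps_coeff \<sigma> 0 = 1 \<and>
                 lie_deriv (linear_vfield As) \<sigma> = 0 \<and>
                 lie_bracket h (\<sigma> *s f) = \<alpha>' *s (\<sigma> *s f) \<and>
                 lie_deriv (linear_vfield As) \<alpha>' = 0 \<and>
                 lie_deriv (linear_vfield Cs) \<alpha>' = 0)))"
proof -
  note f0 = assms(1)
  have jc: "jordan_chevalley (linear_part f) As An" using assms(2,3) by simp
  have Sf: "lie_bracket (linear_vfield As) f = 0"
    using assms(4) jc by (auto simp: poincare_dulac_nf_def)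
  have value0: "value_at_0 (k - \<beta> *s f) = 0" if "value_at_0 k = 0" for k \<beta>
    using that f0 by (simp add: value_at_0_def vec_eq_iff mfps_coeff_mult_0)
  have commutes: "lie_bracket (linear_vfield As) (k - \<beta> *s f) = 0"
    if "lie_bracket (k - \<beta> *s f) f = \<alpha> *s f" "lie_deriv (linear_vfield As) \<alpha> = 0" for k \<beta> \<alpha>
    using normalizing_field_commutes_semisimple_part[OF f0 jc Sf that] .
  have vanishes: "mfps_coeff \<alpha> 0 = 0"
    if "value_at_0 k = 0" "lie_bracket (k - \<beta> *s f) f = \<alpha> *s f" "lie_deriv (linear_vfield As) \<alpha> = 0" for k \<beta> \<alpha>
    using normalizing_factor_vanishes_at_0[OF f0 value0[OF that(1)] jc assms(5) that(2) commutes[OF that(2,3)]] .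
  have "\<exists>\<beta> \<alpha>. lie_bracket (g - \<beta> *s f) f = \<alpha> *s f \<and>
      lie_deriv (linear_vfield As) \<alpha> = 0 \<and> mfps_coeff \<alpha> 0 = 0"
    using normalizer_adjust[OF f0 jc Sf assms(6)] vanishes[OF assms(7)] by metis
  moreover have "normalizer f = {h + \<beta> *s f | h \<beta>. h \<in> centralizer f}"
    if const: "\<forall>\<phi>. first_integral (linear_vfield As) \<phi> \<longrightarrow> (\<exists>c. \<phi> = mfps_const c)"
  proof (intro equalityI subsetI)
    fix k assume k: "k \<in> normalizer f"
    have k0: "value_at_0 k = 0"
      using normalizer_value_at_0[OF f0 jc _ k] const by blast
    obtain \<beta> \<alpha> where \<beta>: "lie_bracket (k - \<beta> *s f) f = \<alpha> *s f" "lie_deriv (linear_vfield As) \<alpha> = 0"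
      by (rule normalizer_adjust[OF f0 jc Sf k])
    obtain c where "\<alpha> = mfps_const c" using const \<beta>(2) by (auto simp: first_integral_def)
    with vanishes[OF k0 \<beta>] have "\<alpha> = 0" by (simp add: mfps_coeff_const)
    with \<beta> have "k - \<beta> *s f \<in> centralizer f" by (simp add: centralizer_def)
    moreover have "k = (k - \<beta> *s f) + \<beta> *s f" by simp
    ultimately show "k \<in> {h + \<beta> *s f | h \<beta>. h \<in> centralizer f}" by blast
  next
    fix k assume "k \<in> {h + \<beta> *s f | h \<beta>. h \<in> centralizer f}"
    then obtain h \<beta> where k: "k = h + \<beta> *s f" "lie_bracket h f = 0" by (auto simp: centralizer_def)
    have "lie_bracket k f = (- lie_deriv f \<beta>) *s f"
      unfolding k(1) using k(2) by (simp add: lie_bracket_add_left lie_bracket_scale_left lie_bracket_self vec_eq_iff)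
    then show "k \<in> normalizer f" unfolding normalizer_def by blast
  qed
  moreover have "\<exists>\<sigma> \<alpha>'. \<sigma> dvd 1 \<and> mfps_coeff \<sigma> 0 = 1 \<and> lie_deriv (linear_vfield As) \<sigma> = 0 \<and>
      lie_bracket h (\<sigma> *s f) = \<alpha>' *s (\<sigma> *s f) \<and>
      lie_deriv (linear_vfield As) \<alpha>' = 0 \<and> lie_deriv (linear_vfield Cs) \<alpha>' = 0"
    if hf: "lie_bracket h f = \<alpha> *s f" and \<alpha>: "lie_deriv (linear_vfield As) \<alpha> = 0"
      and h: "h = g - \<beta> *s f" and C: "jordan_chevalley (linear_part h) Cs Cn" for \<beta> \<alpha> h Cs Cn
  proof -
    have h0: "value_at_0 h = 0" unfolding h by (rule value0[OF assms(7)])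
    have Sh: "lie_bracket (linear_vfield As) h = 0"
      using commutes[of g \<beta>] hf \<alpha> unfolding h by blast
    note comm = jordan_chevalley_commutes[OF C linear_part_commutes[OF h0 Sh]]
    have lin: "linear_part h = Cs + Cn" and Cs: "semisimple_matrix Cs" and Cn: "nilpotent_matrix Cn"
      and CsCn: "Cs ** Cn = Cn ** Cs" using C by (auto simp: jordan_chevalley_def)
    \<comment> \<open>The split is now taken along \<open>h\<close> inside the first integrals of
      \<open>As\<close>, so that \<open>u\<close> is killed by both semisimple parts.\<close>
    obtain u w where u: "lie_deriv (linear_vfield As) u = 0" "lie_deriv (linear_vfield Cs) u = 0"
      and w: "lie_deriv (linear_vfield As) w = 0" "mfps_coeff w 0 = 0" and \<alpha>_eq: "\<alpha> = u + lie_deriv h w"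
      by (rule homological_split[OF h0 lin Cs Cn CsCn _ _ Sh \<alpha>])
        (use comm in \<open>auto simp: lie_bracket_linear_eq_0_iff\<close>)
    \<comment> \<open>Since X_h(\<sigma>) = - X_h(w) \<sigma>, the new factor is \<alpha> - X_h(w),
      which is \<open>u\<close>.\<close>
    let ?\<sigma> = "mfps_exp (- w)"
    have "lie_bracket h (?\<sigma> *s f) = u *s (?\<sigma> *s f)"
      using lie_deriv_exp[OF h0, of "- w"] w(2) unfolding lie_bracket_scale_right hf \<alpha>_eq
      by (simp add: vec_eq_iff lie_deriv_uminus algebra_simps)
    moreover have "lie_deriv (linear_vfield As) ?\<sigma> = 0"
      using lie_deriv_exp[OF value_at_0_linear_vfield, of "- w" As] w by (simp add: lie_deriv_uminus)
    ultimately show ?thesis using u mfps_exp_dvd_1 mfps_coeff_exp_0 by blast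
  qed
  ultimately show ?thesis
    using vanishes[OF assms(7)] commutes by (auto; blast)
qed

end
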